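(* Let $q$ be a fixed odd prime power, and let $i_O(2n+1,q)$ be the number of involutions in $O(2n+1,q)$. Then $$\lim_{n \rightarrow \infty} \frac{i_O(2n+1,q)}{q^{n^2+n}} = 2 \prod_{i \geq 1} \left(1+\frac{1}{q^{2i}}\right)^2 .$$
   Context: $O(2n+1,q)$ is the stabilizer (full isometry group) of a nondegenerate quadratic form on a $(2n+1)$-dimensional vector space over the field with $q$ elements, $q$ odd (the group is, up to isomorphism, independent of the choice of form). "Involution" means an element $g$ with $g^2=1$ (the identity is counted). *)

theory Defs
  imports
    "HOL-Analysis.Infinite_Products"
    "HOL-Number_Theory.Prime_Powers"
    "Jordan_Normal_Form.Matrix"
begin

text \<open>
  The \<open>m\<close>-dimensional space over the field \<open>'a\<close> is \<open>carrier_vec m\<close>; only the values of a form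
  on this carrier are relevant.
\<close>

definition polar_form :: "('a::field vec \<Rightarrow> 'a) \<Rightarrow> 'a vec \<Rightarrow> 'a vec \<Rightarrow> 'a" where
  "polar_form Q u v = Q (u + v) - Q u - Q v"

text \<open>The polar form is symmetric, so linearity in the first argument makes it bilinear.\<close>

definition quadratic_form :: "nat \<Rightarrow> ('a::field vec \<Rightarrow> 'a) \<Rightarrow> bool" where
  "quadratic_form m Q \<longleftrightarrow>
     (\<forall>c. \<forall>v\<in>carrier_vec m. Q (c \<cdot>\<^sub>v v) = c\<^sup>2 * Q v) \<and>
     (\<forall>u\<in>carrier_vec m. \<forall>v\<in>carrier_vec m. \<forall>w\<in>carrier_vec m.
        polar_form Q (u + v) w = polar_form Q u w + polar_form Q v w) \<and>
     (\<forall>c. \<forall>u\<in>carrier_vec m. \<forall>w\<in>carrier_vec m.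
        polar_form Q (c \<cdot>\<^sub>v u) w = c * polar_form Q u w)"

text \<open>
  Triviality of the radical of the polar form; this is the standard notion of nondegeneracy
  in characteristic other than 2.
\<close>

definition nondegenerate :: "nat \<Rightarrow> ('a::field vec \<Rightarrow> 'a) \<Rightarrow> bool" where
  "nondegenerate m Q \<longleftrightarrow>
     (\<forall>v\<in>carrier_vec m. (\<forall>w\<in>carrier_vec m. polar_form Q v w = 0) \<longrightarrow> v = 0\<^sub>v m)"

definition orthogonal_group :: "nat \<Rightarrow> ('a::field vec \<Rightarrow> 'a) \<Rightarrow> 'a mat set" where
  "orthogonal_group m Q =
     {g \<in> carrier_mat m m. invertible_mat g \<and> (\<forall>v\<in>carrier_vec m. Q (g *\<^sub>v v) = Q v)}"

text \<open>The identity is counted as an involution.\<close>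

definition involutions :: "nat \<Rightarrow> ('a::field vec \<Rightarrow> 'a) \<Rightarrow> 'a mat set" where
  "involutions m Q = {g \<in> orthogonal_group m Q. g * g = 1\<^sub>m m}"

definition num_involutions :: "nat \<Rightarrow> ('a::field vec \<Rightarrow> 'a) \<Rightarrow> nat" where
  "num_involutions m Q = card (involutions m Q)"

end

theory Submission
  imports
    Defs
    "HOL-Analysis.Uniform_Limit"
    "HOL-Library.Nat_Bijection"
    "HOL-Library.Function_Algebras"
begin

text \<open>
  An involution \<open>g\<close> splits the space orthogonally as \<open>M \<oplus> M\<^sup>\<bottom>\<close> with \<open>M = ker (g + 1)\<close>, and is
  determined by \<open>M\<close>, so one counts the subspaces \<open>M\<close> that admit such a splitting.  Passing to
  \<open>M\<^sup>\<bottom>\<close> exchanges even and odd dimensions, so those of even dimension \<open>2m\<close> suffice; their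
  complement has odd dimension.  Counting in two ways the pairs of such an \<open>M\<close> and a hyperbolic
  pair orthogonal to it relates \<open>V\<close> to spaces of dimension two less.  The number of hyperbolic
  pairs of an odd-dimensional space does not depend on the form, which gives the count
  \<open>q ^ (2m (2(n-m) + 1))\<close> times the Gaussian binomial of \<open>n\<close> over \<open>m\<close> in base \<open>q ^ -2\<close>.

  After normalisation this is a sum over triangular numbers with Gaussian coefficients.  By
  Tannery's theorem it has the same limit as a finite version of the Jacobi triple product (at
  \<open>z = 1\<close>), which evaluates to \<open>\<Prod> (1 + q ^ -2i)\<^sup>2\<close>.
\<close>

section \<open>Triangular sums and the Jacobi triple product\<close>

text \<open>Odd-dimensional complements are what make the double count close up. In even dimension
  there are two types of forms, with different numbers of singular vectors, so a recursion through
  even-dimensional complements would have to keep the types apart. Here the subspaces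
  \<open>M\<close> of both types are lumped together and only their complements are examined. The
  recursion keeps \<open>m\<close> and lowers \<open>n\<close> until the complement is a line.

  The limit series is never summed directly. Each Gaussian coefficient enters it only through its
  limit \<open>1 / L\<close>, where \<open>L\<close> is the limit of \<open>qpoch x\<close>, so any
  other family of coefficients with that limit yields the same series; the family [2N+1, N-k] has
  finite sums that factor. The base is x = q^-2 in the application, and the factor 2 of the theorem
  is the exchange of \<open>M\<close> with its complement.\<close>

definition qpoch :: "real \<Rightarrow> nat \<Rightarrow> real" where
  "qpoch x n = (\<Prod>i<n. 1 - x ^ Suc i)"

lemma qpoch_0 [simp]: "qpoch x 0 = 1"
  by (simp add: qpoch_def)

lemma qpoch_Suc: "qpoch x (Suc n) = qpoch x n * (1 - x ^ Suc n)"
  by (simp add: qpoch_def)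

context
  fixes x :: real
  assumes x: "0 < x" "x < 1"
begin

lemma qpoch_factor_pos: "0 < 1 - x ^ Suc n"
  using x by (metis diff_gt_0_iff_gt power_Suc_less_one)

lemma qpoch_pos: "0 < qpoch x n"
  unfolding qpoch_def by (rule prod_pos) (use qpoch_factor_pos in blast)

lemma qpoch_le_1: "qpoch x n \<le> 1"
  unfolding qpoch_def
  by (rule prod_le_1) (use x qpoch_factor_pos less_imp_le in auto)

lemma convergent_prod_one_plus_power:
  "convergent_prod (\<lambda>i. 1 + c * x ^ Suc i)"
proof -
  have "summable (\<lambda>i. norm (c * x ^ Suc i))"
    using x by (auto simp: abs_mult power_abs intro!: summable_mult summable_geometric)
  then show ?thesis
    using summable_imp_abs_convergent_prod[of "\<lambda>i. 1 + c * x ^ Suc i"]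
      abs_convergent_prod_imp_convergent_prod by auto
qed

text \<open>Positivity of the limit and its being a lower bound are both needed later: together they
  bound the reciprocals of all \<open>qpoch x n\<close> uniformly.\<close>

lemma qpoch_tendsto:
  obtains L where "0 < L" "qpoch x \<longlonglongrightarrow> L" "\<And>n. L \<le> qpoch x n"
proof -
  have c: "convergent_prod (\<lambda>i. 1 - x ^ Suc i)"
    using convergent_prod_one_plus_power[of "-1"] by simp
  define L where "L = (\<Prod>i. 1 - x ^ Suc i)"
  have lim: "qpoch x \<longlonglongrightarrow> L"
    using has_prod_imp_tendsto'[OF convergent_prod_has_prod[OF c]]
    unfolding L_def qpoch_def by simp
  have "L \<noteq> 0"
    unfolding L_def by (rule prodinf_nonzero[OF c]) (metis less_irrefl qpoch_factor_pos)
  moreover have "0 \<le> L"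
    using LIMSEQ_le_const[OF lim] qpoch_pos less_imp_le by blast
  moreover have "decseq (qpoch x)"
  proof (rule decseq_SucI)
    fix n
    have "qpoch x n * (1 - x ^ Suc n) \<le> qpoch x n * 1"
      by (rule mult_left_mono) (use x qpoch_pos[of n] in auto)
    then show "qpoch x (Suc n) \<le> qpoch x n" by (simp add: qpoch_Suc)
  qed
  then have "\<And>n. L \<le> qpoch x n" using decseq_ge[OF _ lim] by blast
  ultimately show thesis using that[of L] lim by auto
qed

lemma le_triangle: "n \<le> triangle n"
  by (induction n) auto

text \<open>The limit does not depend on \<open>a\<close>, \<open>b\<close> and \<open>c\<close> as
  long as all indices tend to infinity; this is what allows one family of coefficients to be traded
  for another. The majorant is geometric: numerators are at most 1, denominators at least
  \<open>L * L\<close>, and \<open>k \<le> triangle k\<close>.\<close>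

lemma triangle_series_tendsto:
  assumes L: "0 < L" "qpoch x \<longlonglongrightarrow> L" "\<And>n. L \<le> qpoch x n"
    and a: "\<And>k. filterlim (\<lambda>n. a n k) at_top sequentially"
    and b: "\<And>k. filterlim (\<lambda>n. b n k) at_top sequentially"
    and c: "filterlim c at_top sequentially"
  shows "(\<lambda>n. \<Sum>k\<le>n. x ^ triangle k * (qpoch x (c n) / (qpoch x (a n k) * qpoch x (b n k))))
           \<longlonglongrightarrow> (\<Sum>k. x ^ triangle k * (L / (L * L)))"
proof -
  \<comment> \<open>Extension by zero turns the finite sums into series over all \<open>k\<close>,
    the form that Tannery's theorem takes.\<close>
  define f where "f k n = (if k \<le> n then
     x ^ triangle k * (qpoch x (c n) / (qpoch x (a n k) * qpoch x (b n k))) else 0)" for k n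
  have "(\<lambda>n. suminf (\<lambda>k. f k n)) \<longlonglongrightarrow> (\<Sum>k. x ^ triangle k * (L / (L * L)))"
  proof (rule tannerys_theorem[THEN conjunct2, THEN conjunct2])
    fix k
    have "(\<lambda>n. x ^ triangle k * (qpoch x (c n) / (qpoch x (a n k) * qpoch x (b n k))))
        \<longlonglongrightarrow> x ^ triangle k * (L / (L * L))"
      using L(1) by (intro tendsto_intros filterlim_compose[OF L(2)] a b c) auto
    moreover have "\<forall>\<^sub>F n in sequentially.
        f k n = x ^ triangle k * (qpoch x (c n) / (qpoch x (a n k) * qpoch x (b n k)))"
      using eventually_ge_at_top[of k] by eventually_elim (simp add: f_def)
    ultimately show "(\<lambda>n. f k n) \<longlonglongrightarrow> x ^ triangle k * (L / (L * L))"
      by (simp add: filterlim_cong)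
  next
    have "norm (f k n) \<le> x ^ k * (1 / (L * L))" for k n
    proof (cases "k \<le> n")
      case True
      have "x ^ triangle k \<le> x ^ k"
        using x le_triangle by (intro power_decreasing) auto
      moreover have "qpoch x (c n) / (qpoch x (a n k) * qpoch x (b n k)) \<le> 1 / (L * L)"
        using L qpoch_le_1 by (intro frac_le mult_mono) (auto intro: less_imp_le order_trans)
      ultimately have "x ^ triangle k * (qpoch x (c n) / (qpoch x (a n k) * qpoch x (b n k)))
          \<le> x ^ k * (1 / (L * L))"
        using x qpoch_pos by (intro mult_mono) (auto intro!: divide_nonneg_pos less_imp_le[OF qpoch_pos])
      then show ?thesis
        using True x qpoch_pos by (simp add: f_def abs_mult abs_divide abs_of_pos)
    qed (use L x in \<open>auto simp: f_def\<close>)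
    then show "\<forall>\<^sub>F (k, n) in at_top \<times>\<^sub>F sequentially. norm (f k n) \<le> x ^ k * (1 / (L * L))"
      by (intro always_eventually) auto
    show "summable (\<lambda>k. x ^ k * (1 / (L * L)))"
      using x by (intro summable_mult2 summable_geometric) auto
  qed auto
  moreover have "suminf (\<lambda>k. f k n) = (\<Sum>k\<le>n. f k n)" for n
    by (rule suminf_finite) (auto simp: f_def)
  moreover have "(\<Sum>k\<le>n. f k n) =
      (\<Sum>k\<le>n. x ^ triangle k * (qpoch x (c n) / (qpoch x (a n k) * qpoch x (b n k))))" for n
    by (rule sum.cong) (auto simp: f_def)
  ultimately show ?thesis
    by (simp only:)
qed

text \<open>The coefficients below are the Gaussian binomials \<open>[2N+1, N-k]\<close>; this is the finite form
  of the Jacobi triple product at \<open>z = 1\<close>, with the terms \<open>j\<close> and \<open>-1-j\<close> identified.\<close>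

definition gauss_coeff :: "nat \<Rightarrow> nat \<Rightarrow> real" where
  "gauss_coeff N k =
     (if k \<le> N then qpoch x (2 * N + 1) / (qpoch x (N - k) * qpoch x (N + k + 1)) else 0)"

text \<open>Two applications of the q-Pascal rule, one in each of its two forms, lead from upper
  index 2N+3 down to 2N+1. This choice of forms produces powers of \<open>x\<close> that the
  triangular weights absorb.\<close>

lemma gauss_coeff_rec:
  assumes "k \<le> N"
  shows "gauss_coeff (Suc N) (Suc k) = x ^ (N + k + 3) * gauss_coeff N (k + 2)
     + (1 + x ^ (2 * N + 2)) * gauss_coeff N (Suc k) + x ^ (N - k) * gauss_coeff N k"
proof -
  have nz: "qpoch x n \<noteq> 0" "1 - x ^ Suc n \<noteq> 0" "1 - x * x ^ n \<noteq> 0" for n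
    using qpoch_pos[of n] qpoch_factor_pos[of n] by auto
  obtain e where e: "N = k + e" using assms le_Suc_ex by blast
  \<comment> \<open>A common factor: all four coefficients are \<open>C\<close> times a polynomial
    in \<open>x\<close>, which leaves the polynomial identity \<open>id\<close>.\<close>
  define C where "C = qpoch x (2 * N + 1) / (qpoch x e * qpoch x (N + k + 3))"
  have up: "qpoch x (N + k + 3) = qpoch x (N + k + 1) * ((1 - x ^ (N + k + 2)) * (1 - x ^ (N + k + 3)))"
    "qpoch x (N + k + 3) = qpoch x (N + k + 2) * (1 - x ^ (N + k + 3))"
    "qpoch x (2 * N + 3) = qpoch x (2 * N + 1) * ((1 - x ^ (2 * N + 2)) * (1 - x ^ (2 * N + 3)))"
    by (simp_all add: numeral_3_eq_3 numeral_2_eq_2 qpoch_Suc)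
  have fnz: "1 - x ^ (N + k + 2) \<noteq> 0" "1 - x ^ (N + k + 3) \<noteq> 0"
    using nz(2)[of "N + k + 1"] nz(2)[of "N + k + 2"] by (simp_all add: numeral_3_eq_3 numeral_2_eq_2)
  have 0: "gauss_coeff (Suc N) (Suc k) = C * ((1 - x ^ (2 * N + 2)) * (1 - x ^ (2 * N + 3)))"
  proof -
    have *: "2 * Suc N + 1 = 2 * N + 3" "Suc N + Suc k + 1 = N + k + 3" "Suc N - Suc k = e"
      using e by auto
    have "gauss_coeff (Suc N) (Suc k) = qpoch x (2 * N + 3) / (qpoch x e * qpoch x (N + k + 3))"
      unfolding gauss_coeff_def * using assms by auto
    then show ?thesis
      unfolding C_def up(3) by simp
  qed
  have 1: "gauss_coeff N k = C * ((1 - x ^ (N + k + 2)) * (1 - x ^ (N + k + 3)))"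
  proof -
    have "gauss_coeff N k = qpoch x (2 * N + 1) / (qpoch x e * qpoch x (N + k + 1))"
      using e assms by (simp add: gauss_coeff_def)
    then show ?thesis
      unfolding C_def up(1) using fnz nz(1)[of "N + k + 1"] by simp
  qed
  have 2: "gauss_coeff N (Suc k) = C * ((1 - x ^ e) * (1 - x ^ (N + k + 3)))"
  proof (cases e)
    case (Suc d)
    have "N - Suc k = d" "N + Suc k + 1 = N + k + 2" using e Suc by auto
    then show ?thesis
      using e Suc fnz nz(3)[of d] unfolding gauss_coeff_def C_def up(2) by (simp add: qpoch_Suc nz)
  qed (simp add: e gauss_coeff_def)
  \<comment> \<open>For \<open>e \<le> 1\<close> the left side is 0 by the convention in
    \<open>gauss_coeff\<close>, and a factor on the right vanishes as well; at \<open>e = 0\<close>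
    it is the first one, so the truncated \<open>e - 1\<close> does no harm.\<close>
  have 3: "gauss_coeff N (k + 2) = C * ((1 - x ^ e) * (1 - x ^ (e - 1)))"
  proof (cases "e \<le> 1")
    case True
    then have "e = 0 \<or> e = 1" by auto
    then show ?thesis by (auto simp: e gauss_coeff_def)
  next
    case False
    then obtain d where d: "e = Suc (Suc d)" by (metis One_nat_def Suc_le_mono bot_nat_0.extremum not0_implies_Suc)
    have "N - (k + 2) = d" "N + (k + 2) + 1 = N + k + 3" using e d by auto
    moreover have "k + 2 \<le> N" using e d by simp
    ultimately have "gauss_coeff N (k + 2) = qpoch x (2 * N + 1) / (qpoch x d * qpoch x (N + k + 3))"
      by (simp only: gauss_coeff_def if_True)
    moreover have "qpoch x e = qpoch x d * ((1 - x ^ e) * (1 - x ^ (e - 1)))"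
      by (simp add: d qpoch_Suc)
    moreover have "1 - x ^ e \<noteq> 0" "1 - x ^ (e - 1) \<noteq> 0"
      unfolding d using nz(2) by (simp_all del: power_Suc)
    ultimately show ?thesis
      unfolding C_def by simp
  qed
  have id: "(1 - x ^ (2 * N + 2)) * (1 - x ^ (2 * N + 3)) = x ^ (N + k + 3) * ((1 - x ^ e) * (1 - x ^ (e - 1)))
      + (1 + x ^ (2 * N + 2)) * ((1 - x ^ e) * (1 - x ^ (N + k + 3)))
      + x ^ e * ((1 - x ^ (N + k + 2)) * (1 - x ^ (N + k + 3)))"
  proof (cases e)
    case 0
    then have "2 * N = N + k" by (simp add: e)
    then show ?thesis by (simp only: 0 power_0) simp
  next
    case (Suc d)
    define a b where "a = x ^ k" and "b = x ^ d"
    have pw: "x ^ e = x * b" "x ^ (e - 1) = b" "x ^ (N + k + 2) = a * a * b * x ^ 3"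
      "x ^ (N + k + 3) = a * a * b * x ^ 4" "x ^ (2 * N + 2) = a * a * b * b * x ^ 4"
      "x ^ (2 * N + 3) = a * a * b * b * x ^ 5"
      unfolding a_def b_def e Suc
      by (simp_all add: mult_2 power_add power2_eq_square eval_nat_numeral)
    show ?thesis unfolding pw by (simp add: algebra_simps eval_nat_numeral)
  qed
  have "N - k = e" using e by simp
  show ?thesis
    unfolding 0 1 2 3 id \<open>N - k = e\<close> by (simp add: algebra_simps)
qed

text \<open>The general recursion read at \<open>k = -1\<close>: by the symmetry of binomials the
  coefficient with index -1 equals the one with index 0, which accounts for the extra
  \<open>x ^ (N + 1)\<close>.\<close>

lemma gauss_coeff_rec_0:
  "gauss_coeff (Suc N) 0 = (1 + x ^ (N + 1) + x ^ (2 * N + 2)) * gauss_coeff N 0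
     + x ^ (N + 2) * gauss_coeff N 1"
proof -
  have nz: "qpoch x n \<noteq> 0" "1 - x ^ Suc n \<noteq> 0" "1 - x * x ^ n \<noteq> 0" for n
    using qpoch_pos[of n] qpoch_factor_pos[of n] by auto
  define C where "C = qpoch x (2 * N + 1) / (qpoch x (N + 1) * qpoch x (N + 2))"
  have up: "qpoch x (N + 2) = qpoch x (N + 1) * (1 - x ^ (N + 2))"
    "qpoch x (N + 1) = qpoch x N * (1 - x ^ (N + 1))"
    "qpoch x (2 * N + 3) = qpoch x (2 * N + 1) * ((1 - x ^ (2 * N + 2)) * (1 - x ^ (2 * N + 3)))"
    by (simp_all add: numeral_3_eq_3 numeral_2_eq_2 qpoch_Suc)
  have fnz: "1 - x ^ (N + 1) \<noteq> 0" "1 - x ^ (N + 2) \<noteq> 0"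
    using nz(2)[of N] nz(2)[of "N + 1"] by (simp_all add: numeral_2_eq_2)
  have 0: "gauss_coeff (Suc N) 0 = C * ((1 - x ^ (2 * N + 2)) * (1 - x ^ (2 * N + 3)))"
  proof -
    have *: "2 * Suc N + 1 = 2 * N + 3" "Suc N - 0 = N + 1" "Suc N + 0 + 1 = N + 2" by auto
    show ?thesis unfolding gauss_coeff_def C_def * by (simp add: up(3))
  qed
  have 1: "gauss_coeff N 0 = C * ((1 - x ^ (N + 1)) * (1 - x ^ (N + 2)))"
  proof -
    have "qpoch x (2 * N + 1) / (qpoch x N * qpoch x (N + 1)) =
      C * ((1 - x ^ (N + 1)) * (1 - x ^ (N + 2)))"
      unfolding C_def up(1) up(2) using fnz nz(1)[of N] by simp
    then show ?thesis by (simp add: gauss_coeff_def)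
  qed
  have 2: "gauss_coeff N 1 = C * ((1 - x ^ N) * (1 - x ^ (N + 1)))"
  proof (cases N)
    case (Suc d)
    have "N - 1 = d" "N + 1 + 1 = N + 2" using Suc by auto
    moreover have "qpoch x (N + 1) = qpoch x d * ((1 - x ^ N) * (1 - x ^ (N + 1)))"
      by (simp add: Suc qpoch_Suc)
    ultimately show ?thesis
      using Suc fnz nz(2)[of d] nz(1) unfolding gauss_coeff_def C_def by simp
  qed (simp add: gauss_coeff_def)
  have id: "(1 - x ^ (2 * N + 2)) * (1 - x ^ (2 * N + 3)) =
      (1 + x ^ (N + 1) + x ^ (2 * N + 2)) * ((1 - x ^ (N + 1)) * (1 - x ^ (N + 2)))
      + x ^ (N + 2) * ((1 - x ^ N) * (1 - x ^ (N + 1)))"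
  proof -
    define a where "a = x ^ N"
    have pw: "x ^ (N + 1) = a * x" "x ^ (N + 2) = a * x ^ 2" "x ^ (2 * N + 2) = a * a * x ^ 2"
      "x ^ (2 * N + 3) = a * a * x ^ 3" "x ^ N = a"
      unfolding a_def by (simp_all add: mult_2 power_add power2_eq_square eval_nat_numeral)
    show ?thesis unfolding pw by (simp add: algebra_simps eval_nat_numeral)
  qed
  show ?thesis
    unfolding 0 1 2 id by (simp add: algebra_simps)
qed

text \<open>With the triangular weights the recursion has coefficients independent of
  \<open>k\<close>: \<open>x ^ (N + 1)\<close>, \<open>1 + x ^ (2 * N + 2)\<close> and
  \<open>x ^ (N + 1)\<close>. They add up to \<open>(1 + x ^ Suc N)\<^sup>2\<close>, and the
  boundary terms lost in the index shifts are exactly those supplied by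
  \<open>gauss_coeff_rec_0\<close>.\<close>

lemma sum_triangle_gauss_coeff:
  "(\<Sum>k\<le>N. x ^ triangle k * gauss_coeff N k) = (\<Prod>i<N. (1 + x ^ Suc i)\<^sup>2)"
proof (induction N)
  case 0
  show ?case using qpoch_pos[of 1] by (simp add: gauss_coeff_def)
next
  case (Suc N)
  define t where "t k = x ^ triangle k * gauss_coeff N k" for k
  define S where "S = (\<Sum>k\<le>N. t k)"
  have van: "t k = 0" if "N < k" for k using that by (simp add: t_def gauss_coeff_def)
  have S1: "(\<Sum>k\<le>N. t (Suc k)) = S - t 0"
    using sum.atMost_Suc_shift[of t N] van[of "Suc N"] by (simp add: S_def)
  have S2: "(\<Sum>k\<le>N. t (k + 2)) = S - t 0 - t 1"
    using sum.atMost_Suc_shift[of "\<lambda>k. t (Suc k)" N] van[of "Suc (Suc N)"] S1 by simp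
  \<comment> \<open>The exponents match because consecutive triangular numbers differ by the larger
    index: k+2 on the one side, k+1 on the other.\<close>
  have step: "x ^ triangle (Suc k) * gauss_coeff (Suc N) (Suc k) =
      x ^ (N + 1) * t (k + 2) + (1 + x ^ (2 * N + 2)) * t (Suc k) + x ^ (N + 1) * t k"
    if "k \<le> N" for k
  proof -
    have "x ^ triangle (Suc k) * x ^ (N + k + 3) = x ^ (N + 1) * x ^ triangle (k + 2)"
      by (simp flip: power_add add: eval_nat_numeral ac_simps)
    moreover have "x ^ triangle (Suc k) * x ^ (N - k) = x ^ (N + 1) * x ^ triangle k"
      using that by (simp flip: power_add power_Suc add: add.commute)
    moreover have "A * (p * g + c * g' + r * g'') = A * p * g + c * (A * g') + A * r * g''"
      for A p g c g' r g'' :: real by (simp add: algebra_simps)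
    ultimately show ?thesis
      unfolding gauss_coeff_rec[OF that] t_def by (simp only: mult.assoc[symmetric])
  qed
  have "(\<Sum>k\<le>Suc N. x ^ triangle k * gauss_coeff (Suc N) k) =
      gauss_coeff (Suc N) 0 + (\<Sum>k\<le>N. x ^ triangle (Suc k) * gauss_coeff (Suc N) (Suc k))"
    by (subst sum.atMost_Suc_shift) simp
  also have "(\<Sum>k\<le>N. x ^ triangle (Suc k) * gauss_coeff (Suc N) (Suc k)) =
      x ^ (N + 1) * (S - t 0 - t 1) + (1 + x ^ (2 * N + 2)) * (S - t 0) + x ^ (N + 1) * S"
  proof -
    have "(\<Sum>k\<le>N. x ^ triangle (Suc k) * gauss_coeff (Suc N) (Suc k)) =
        (\<Sum>k\<le>N. x ^ (N + 1) * t (k + 2) + (1 + x ^ (2 * N + 2)) * t (Suc k) + x ^ (N + 1) * t k)"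
      by (rule sum.cong) (use step in auto)
    then show ?thesis
      by (simp only: sum.distrib sum_distrib_left[symmetric] S1 S2 S_def[symmetric])
  qed
  also have "gauss_coeff (Suc N) 0 + \<dots> = (1 + x ^ Suc N)\<^sup>2 * S"
  proof -
    define y where "y = x ^ Suc N"
    have pw: "x ^ (2 * N + 2) = y * y" "x ^ (N + 2) = y * x" "x ^ (N + 1) = y"
      unfolding y_def by (simp_all flip: power_add power_Suc power_Suc2 add: mult_2)
    have t01: "t 0 = gauss_coeff N 0" "t 1 = x * gauss_coeff N 1"
      by (simp_all add: t_def)
    show ?thesis
      unfolding gauss_coeff_rec_0 y_def[symmetric] pw t01 by (simp add: power2_eq_square algebra_simps)
  qed
  also have "S = (\<Prod>i<N. (1 + x ^ Suc i)\<^sup>2)"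
    using Suc.IH by (simp only: S_def t_def)
  finally show ?case by (simp only: prod.lessThan_Suc mult.commute)
qed

section \<open>Evaluation of the limit series\<close>

text \<open>Both coefficient families converge to the same series. The triple product evaluates it
  through the first, and the value is then carried over to the second, which is the one that arises
  from counting.\<close>

lemma sum_triangle_tendsto:
  "(\<lambda>n. \<Sum>k\<le>n. x ^ triangle k *
      (qpoch x n / (qpoch x ((n - k) div 2) * qpoch x ((n + k + 1) div 2))))
     \<longlonglongrightarrow> (\<Prod>i. (1 + x ^ Suc i)\<^sup>2)"
proof -
  obtain L where L: "0 < L" "qpoch x \<longlonglongrightarrow> L" "\<And>n. L \<le> qpoch x n"
    by (rule qpoch_tendsto) blast
  have lin: "filterlim f at_top sequentially" if "\<And>n. n \<le> 2 * f n + C" for f :: "nat \<Rightarrow> nat" and C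
    unfolding filterlim_at_top
  proof
    fix Z
    show "\<forall>\<^sub>F n in sequentially. Z \<le> f n"
      using eventually_ge_at_top[of "2 * Z + C"]
    proof eventually_elim
      case (elim n)
      then show ?case using that[of n] by linarith
    qed
  qed
  have "(\<lambda>N. \<Sum>k\<le>N. x ^ triangle k *
      (qpoch x (2 * N + 1) / (qpoch x (N - k) * qpoch x (N + k + 1))))
     \<longlonglongrightarrow> (\<Sum>k. x ^ triangle k * (L / (L * L)))"
  proof (rule triangle_series_tendsto[OF L])
    show "filterlim (\<lambda>n. n - k) at_top sequentially" for k by (rule lin[of _ k]) auto
    show "filterlim (\<lambda>n. n + k + 1) at_top sequentially" for k by (rule lin[of _ 0]) auto
    show "filterlim (\<lambda>n. 2 * n + 1 :: nat) at_top sequentially" by (rule lin[of _ 0]) auto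
  qed
  also have "(\<lambda>N. \<Sum>k\<le>N. x ^ triangle k *
      (qpoch x (2 * N + 1) / (qpoch x (N - k) * qpoch x (N + k + 1)))) =
      (\<lambda>N. \<Prod>i<N. (1 + x ^ Suc i)\<^sup>2)"
    unfolding sum_triangle_gauss_coeff[symmetric] by (simp add: gauss_coeff_def)
  finally have "(\<lambda>N. \<Prod>i<N. (1 + x ^ Suc i)\<^sup>2) \<longlonglongrightarrow> (\<Sum>k. x ^ triangle k * (L / (L * L)))" .
  moreover have "convergent_prod (\<lambda>i. (1 + x ^ Suc i)\<^sup>2)"
    using convergent_prod_one_plus_power[of 1] by (auto simp: power2_eq_square intro!: convergent_prod_mult)
  then have "(\<lambda>N. \<Prod>i<N. (1 + x ^ Suc i)\<^sup>2) \<longlonglongrightarrow> (\<Prod>i. (1 + x ^ Suc i)\<^sup>2)"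
    by (intro has_prod_imp_tendsto' convergent_prod_has_prod)
  ultimately have "(\<Prod>i. (1 + x ^ Suc i)\<^sup>2) = (\<Sum>k. x ^ triangle k * (L / (L * L)))"
    using LIMSEQ_unique by blast
  \<comment> \<open>For \<open>k \<le> n\<close> the two halved indices add up to \<open>n\<close>
    in either parity, so these quotients are again Gaussian binomials.\<close>
  moreover have "(\<lambda>n. \<Sum>k\<le>n. x ^ triangle k *
      (qpoch x n / (qpoch x ((n - k) div 2) * qpoch x ((n + k + 1) div 2))))
     \<longlonglongrightarrow> (\<Sum>k. x ^ triangle k * (L / (L * L)))"
  proof (rule triangle_series_tendsto[OF L])
    show "filterlim (\<lambda>n. (n - k) div 2) at_top sequentially" for k
      by (rule lin[of _ "k + 2"]) presburger
    show "filterlim (\<lambda>n. (n + k + 1) div 2) at_top sequentially" for k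
      by (rule lin[of _ 2]) presburger
    show "filterlim (\<lambda>n. n :: nat) at_top sequentially" by (rule lin[of _ 0]) auto
  qed
  ultimately show ?thesis by simp
qed

text \<open>\<open>n - 2 * m\<close> runs over the integers \<open>j\<close> of one parity; \<open>k\<close> is \<open>j\<close> or \<open>-1-j\<close>, whichever is
  nonnegative, and both have the same triangular number.\<close>

lemma sum_exponents_tendsto:
  "(\<lambda>n. \<Sum>m\<le>n. x ^ (triangle (if 2 * m \<le> n then n - 2 * m else 2 * m - n - 1)) *
      (qpoch x n / (qpoch x m * qpoch x (n - m))))
     \<longlonglongrightarrow> (\<Prod>i. (1 + x ^ Suc i)\<^sup>2)"
proof -
  have "(\<Sum>m\<le>n. x ^ (triangle (if 2 * m \<le> n then n - 2 * m else 2 * m - n - 1)) *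
      (qpoch x n / (qpoch x m * qpoch x (n - m)))) =
    (\<Sum>k\<le>n. x ^ triangle k * (qpoch x n / (qpoch x ((n - k) div 2) * qpoch x ((n + k + 1) div 2))))"
    for n
  proof (rule sum.reindex_bij_witness[where
        i = "\<lambda>k. if even (n + k) then (n - k) div 2 else (n + k + 1) div 2" and
        j = "\<lambda>m. if 2 * m \<le> n then n - 2 * m else 2 * m - n - 1"])
    fix m assume "m \<in> {..n}"
    then have m: "m \<le> n" by simp
    let ?k = "if 2 * m \<le> n then n - 2 * m else 2 * m - n - 1"
    \<comment> \<open>The halved indices are \<open>m\<close> and \<open>n - m\<close>, in an order
      that depends on the branch; the coefficient is symmetric in them.\<close>
    have "(if even (n + ?k) then (n - ?k) div 2 else (n + ?k + 1) div 2) = m \<and> ?k \<le> n \<and>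
        ((n - ?k) div 2 = m \<and> (n + ?k + 1) div 2 = n - m \<or>
         (n - ?k) div 2 = n - m \<and> (n + ?k + 1) div 2 = m)"
    proof (cases "2 * m \<le> n")
      case True
      then obtain d where "n = 2 * m + d" using le_Suc_ex by blast
      then show ?thesis by simp
    next
      case False
      define d where "d = 2 * m - n - 1"
      define e where "e = n - m"
      have "m = d + 1 + e" "n = d + 1 + 2 * e" using m False by (auto simp: d_def e_def)
      then show ?thesis by simp
    qed
    note * = this
    show "(if even (n + ?k) then (n - ?k) div 2 else (n + ?k + 1) div 2) = m"
      using * by blast
    show "?k \<in> {..n}"
      using * by blast
    have "qpoch x ((n - ?k) div 2) * qpoch x ((n + ?k + 1) div 2) = qpoch x m * qpoch x (n - m)"
      using * by (metis mult.commute)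
    then show "x ^ triangle ?k * (qpoch x n / (qpoch x ((n - ?k) div 2) * qpoch x ((n + ?k + 1) div 2))) =
       x ^ triangle ?k * (qpoch x n / (qpoch x m * qpoch x (n - m)))"
      by (simp only:)
  next
    fix k assume "k \<in> {..n}"
    then have k: "k \<le> n" by simp
    let ?m = "if even (n + k) then (n - k) div 2 else (n + k + 1) div 2"
    have "(if 2 * ?m \<le> n then n - 2 * ?m else 2 * ?m - n - 1) = k \<and> ?m \<le> n"
    proof (cases "even (n + k)")
      case True
      then have "even (n - k)" using k by simp
      then obtain e where "n = k + 2 * e" using k by (metis dvdE le_add_diff_inverse)
      then show ?thesis by simp
    next
      case False
      then have "odd (n - k)" using k by simp
      then obtain e where "n = k + 2 * e + 1" using k by (metis add.assoc le_add_diff_inverse oddE)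
      then show ?thesis by simp
    qed
    then show "(if 2 * ?m \<le> n then n - 2 * ?m else 2 * ?m - n - 1) = k" and "?m \<in> {..n}"
      by blast+
  qed
  then show ?thesis using sum_triangle_tendsto by simp
qed

end

section \<open>Orthogonal splittings over a finite field of odd order\<close>

text \<open>The spaces under study are finite subspaces of one ambient group, not whole types, so
  that an orthogonal complement is an object of the same kind and inductions can pass to it. In the
  application \<open>B\<close> is the polar form, hence \<open>B x x\<close> is twice the value of
  the quadratic form.\<close>

locale symmetric_form = vector_space scale
  for scale :: "'a::{field, finite} \<Rightarrow> 'v::ab_group_add \<Rightarrow> 'v" (infixr "\<star>" 75) +
  fixes B :: "'v \<Rightarrow> 'v \<Rightarrow> 'a"
  assumes add_left: "B (x + y) z = B x z + B y z"
    and scale_left: "B (c \<star> x) z = c * B x z"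
    and sym: "B x y = B y x"
    and odd_card: "odd CARD('a)"
begin

lemma add_right: "B z (x + y) = B z x + B z y"
  by (metis add_left sym)

lemma scale_right: "B z (c \<star> x) = c * B z x"
  by (metis scale_left sym)

lemma zero_left [simp]: "B 0 z = 0"
  using scale_left[of 0 0 z] by simp

lemma zero_right [simp]: "B z 0 = 0"
  by (metis zero_left sym)

lemma diff_left: "B (x - y) z = B x z - B y z"
  using add_left[of "x - y" y z] by simp

lemma diff_right: "B z (x - y) = B z x - B z y"
  by (metis diff_left sym)

lemmas B_simps = add_left add_right scale_left scale_right diff_left diff_right

text \<open>Shifting the sum of all field elements by 1 shows that \<open>CARD('a)\<close> is zero
  in the field; if 2 were zero too, oddness would give 1 = 0.\<close>

lemma two_neq_0: "(2 :: 'a) \<noteq> 0"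
proof
  assume two: "(2 :: 'a) = 0"
  have "(\<Sum>x\<in>(UNIV :: 'a set). x) = (\<Sum>x\<in>(UNIV :: 'a set). x + 1)"
    by (rule sum.reindex_bij_witness[where i = "\<lambda>x. x + 1" and j = "\<lambda>x. x - 1"]) auto
  then have "of_nat CARD('a) = (0 :: 'a)"
    by (simp add: sum.distrib)
  moreover obtain k where "CARD('a) = 2 * k + 1"
    using odd_card by (metis oddE)
  ultimately show False using two by simp
qed

definition perp :: "'v set \<Rightarrow> 'v set \<Rightarrow> 'v set" where
  "perp U M = {x \<in> U. \<forall>y\<in>M. B x y = 0}"

definition nondeg :: "'v set \<Rightarrow> bool" where
  "nondeg U \<longleftrightarrow> subspace U \<and> finite U \<and> (\<forall>x\<in>U. (\<forall>y\<in>U. B x y = 0) \<longrightarrow> x = 0)"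

text \<open>The existence of orthogonal projections is the definition, so decompositions are
  available without any dimension formula. Directness of the sum comes from nondegeneracy of
  \<open>U\<close>, in \<open>splits_inter\<close>.\<close>

definition splits :: "'v set \<Rightarrow> 'v set set" where
  "splits U = {M. subspace M \<and> M \<subseteq> U \<and> (\<forall>x\<in>U. \<exists>a\<in>M. x - a \<in> perp U M)}"

text \<open>Zero is included, which makes the count in odd dimension a pure power of q. It
  contributes nothing to \<open>hyperbolic_pairs\<close>, since it has no partners.\<close>

definition singular :: "'v set \<Rightarrow> 'v set" where
  "singular U = {x \<in> U. B x x = 0}"

definition partners :: "'v set \<Rightarrow> 'v \<Rightarrow> 'v set" where
  "partners U u = {v \<in> U. B v v = 0 \<and> B v u = 1}"

definition hyperbolic_pairs :: "'v set \<Rightarrow> ('v \<times> 'v) set" where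
  "hyperbolic_pairs U = (SIGMA u : singular U. partners U u)"

definition splits_of_dim :: "'v set \<Rightarrow> nat \<Rightarrow> 'v set set" where
  "splits_of_dim U k = {M \<in> splits U. card M = CARD('a) ^ k}"

lemma CARD_gt_1: "1 < CARD('a)"
proof -
  have "card {0, 1 :: 'a} \<le> CARD('a)" by (rule card_mono) auto
  then show ?thesis by simp
qed

section \<open>Orthogonal complements and cardinalities of subspaces\<close>

lemma subspace_perp: "subspace U \<Longrightarrow> subspace (perp U M)"
  by (rule subspaceI) (auto simp: perp_def B_simps subspace_0 subspace_add subspace_scale)

lemma perp_subset: "perp U M \<subseteq> U"
  by (auto simp: perp_def)

lemma nondegD: "nondeg U \<Longrightarrow> subspace U" "nondeg U \<Longrightarrow> finite U"
  by (auto simp: nondeg_def)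

lemma splitsE:
  assumes "M \<in> splits U" "x \<in> U"
  obtains a b where "a \<in> M" "b \<in> perp U M" "x = a + b"
proof -
  obtain a where "a \<in> M" "x - a \<in> perp U M"
    using assms by (auto simp: splits_def)
  then show thesis using that[of a "x - a"] by simp
qed

text \<open>Such an \<open>x\<close> is orthogonal to \<open>M\<close> and to its complement, hence
  to their sum \<open>U\<close>.\<close>

lemma splits_inter:
  assumes "nondeg U" "M \<in> splits U" "x \<in> M" "x \<in> perp U M"
  shows "x = 0"
proof -
  have "B x y = 0" if y: "y \<in> U" for y
  proof -
    obtain a b where ab: "a \<in> M" "b \<in> perp U M" "y = a + b"
      using splitsE[OF assms(2) y] .
    have "B x a = 0" using assms(4) ab(1) by (auto simp: perp_def)
    moreover have "B b x = 0" using assms(3) ab(2) by (auto simp: perp_def)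
    ultimately show ?thesis using ab(3) by (simp add: B_simps sym)
  qed
  moreover have "x \<in> U" using assms(4) by (auto simp: perp_def)
  ultimately show ?thesis using assms(1) by (auto simp: nondeg_def)
qed

lemma nondeg_perp:
  assumes "nondeg U" "M \<in> splits U"
  shows "nondeg (perp U M)"
  unfolding nondeg_def
proof (intro conjI ballI impI)
  show "subspace (perp U M)" using assms subspace_perp nondegD by blast
  show "finite (perp U M)" using assms perp_subset nondegD finite_subset by metis
next
  fix x assume x: "x \<in> perp U M" "\<forall>y\<in>perp U M. B x y = 0"
  have "B x y = 0" if y: "y \<in> U" for y
  proof -
    obtain a b where ab: "a \<in> M" "b \<in> perp U M" "y = a + b"
      using splitsE[OF assms(2) y] .
    then show ?thesis using x by (auto simp: perp_def B_simps)
  qed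
  moreover have "x \<in> U" using x(1) by (auto simp: perp_def)
  ultimately show "x = 0" using assms(1) by (auto simp: nondeg_def)
qed

lemma perp_perp:
  assumes "nondeg U" "M \<in> splits U"
  shows "perp U (perp U M) = M"
proof
  show "M \<subseteq> perp U (perp U M)"
    using assms(2) by (auto simp: splits_def perp_def sym)
  show "perp U (perp U M) \<subseteq> M"
  proof
    fix x assume x: "x \<in> perp U (perp U M)"
    then have "x \<in> U" by (auto simp: perp_def)
    then obtain a b where ab: "a \<in> M" "b \<in> perp U M" "x = a + b"
      using splitsE[OF assms(2)] by metis
    have "B b y = 0" if "y \<in> perp U M" for y
    proof -
      have "B x y = 0" using x that by (auto simp: perp_def)
      moreover have "B a y = 0" using ab(1) that by (auto simp: perp_def sym)
      ultimately show ?thesis using ab(3) by (simp add: B_simps)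
    qed
    then have "b = 0" using nondeg_perp[OF assms] ab(2) by (auto simp: nondeg_def)
    then show "x \<in> M" using ab by simp
  qed
qed

lemma perp_in_splits:
  assumes "nondeg U" "M \<in> splits U"
  shows "perp U M \<in> splits U"
  unfolding splits_def mem_Collect_eq perp_perp[OF assms]
proof (intro conjI ballI)
  show "subspace (perp U M)" using assms subspace_perp nondegD by blast
  show "perp U M \<subseteq> U" by (rule perp_subset)
next
  fix x assume x: "x \<in> U"
  obtain a b where "a \<in> M" "b \<in> perp U M" "x = a + b" using splitsE[OF assms(2) x] .
  then show "\<exists>a\<in>perp U M. x - a \<in> M" by (intro bexI[of _ b]) auto
qed

lemma card_splits:
  assumes "nondeg U" "M \<in> splits U"
  shows "card M * card (perp U M) = card U"
proof -
  have M: "subspace M" "M \<subseteq> U" and P: "subspace (perp U M)" and U: "subspace U"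
    using assms subspace_perp nondegD by (auto simp: splits_def)
  have "bij_betw (\<lambda>(a, b). a + b) (M \<times> perp U M) U"
  proof (rule bij_betw_imageI)
    show "inj_on (\<lambda>(a, b). a + b) (M \<times> perp U M)"
    proof (intro inj_onI; clarify)
      fix a b a' b'
      assume ab: "a \<in> M" "b \<in> perp U M" "a' \<in> M" "b' \<in> perp U M" "a + b = a' + b'"
      have "a - a' = b' - b" using ab(5) by (simp add: algebra_simps)
      moreover have "a - a' \<in> M" "b' - b \<in> perp U M"
        using ab M P subspace_diff by auto
      ultimately have "a - a' = 0" using splits_inter[OF assms, of "a - a'"] by metis
      then show "a = a' \<and> b = b'" using ab(5) by simp
    qed
    show "(\<lambda>(a, b). a + b) ` (M \<times> perp U M) = U"
    proof
      show "(\<lambda>(a, b). a + b) ` (M \<times> perp U M) \<subseteq> U"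
        using M U perp_subset subspace_add by fastforce
      show "U \<subseteq> (\<lambda>(a, b). a + b) ` (M \<times> perp U M)"
        using splitsE[OF assms(2)] by (smt (verit) case_prod_conv image_iff mem_Sigma_iff subsetI)
    qed
  qed
  then have "card (M \<times> perp U M) = card U"
    by (rule bij_betw_same_card)
  then show ?thesis
    by (simp only: card_cartesian_product)
qed

text \<open>Among the subspaces of \<open>U\<close> whose order is a power of q, a maximal one is
  all of \<open>U\<close>: adjoining a vector outside it multiplies the order by q.\<close>

lemma card_subspace:
  assumes "subspace U" "finite U"
  obtains k where "card U = CARD('a) ^ k"
proof -
  define A where "A = {S. subspace S \<and> S \<subseteq> U \<and> (\<exists>k. card S = CARD('a) ^ k)}"
  have "finite A" using assms(2) by (auto simp: A_def intro: finite_subset[of _ "Pow U"])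
  moreover have "{0} \<in> A"
    using assms(1) by (auto simp: A_def subspace_0 intro: exI[of _ 0])
  ultimately obtain S where S: "S \<in> A" "\<And>T. T \<in> A \<Longrightarrow> S \<subseteq> T \<Longrightarrow> S = T"
    using finite_has_maximal[of A] by blast
  then obtain k where k: "subspace S" "S \<subseteq> U" "card S = CARD('a) ^ k"
    by (auto simp: A_def)
  have "U \<subseteq> S"
  proof (rule ccontr)
    assume "\<not> U \<subseteq> S"
    then obtain x where x: "x \<in> U" "x \<notin> S" by auto
    define T where "T = (\<lambda>(c, s). c \<star> x + s) ` (UNIV \<times> S)"
    have inj: "inj_on (\<lambda>(c, s). c \<star> x + s) (UNIV \<times> S)"
    proof (intro inj_onI; clarify)
      fix c s c' s' assume *: "s \<in> S" "s' \<in> S" "c \<star> x + s = c' \<star> x + s'"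
      have d: "(c - c') \<star> x = s' - s" using *(3) by (simp add: algebra_simps)
      have "c = c'"
      proof (rule ccontr)
        assume "c \<noteq> c'"
        then have "x = inverse (c - c') \<star> (s' - s)" by (simp flip: d)
        then show False using x(2) * k(1) subspace_scale subspace_diff by metis
      qed
      then show "c = c' \<and> s = s'" using * by simp
    qed
    have "card T = CARD('a) ^ Suc k"
      unfolding T_def card_image[OF inj] by (simp add: card_cartesian_product k)
    moreover have "T \<subseteq> U"
      using x k assms(1) by (auto simp: T_def intro!: subspace_add subspace_scale)
    moreover have "subspace T"
    proof (rule subspaceI)
      show "0 \<in> T" using subspace_0[OF k(1)] by (auto simp: T_def image_iff intro!: exI[of _ 0] bexI[of _ 0])
    next
      fix y z assume "y \<in> T" "z \<in> T"
      then obtain c s c' s' where "y = c \<star> x + s" "z = c' \<star> x + s'" "s \<in> S" "s' \<in> S"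
        by (auto simp: T_def)
      then have "y + z = (c + c') \<star> x + (s + s')" "s + s' \<in> S"
        using k(1) by (auto simp: algebra_simps subspace_add)
      then show "y + z \<in> T" by (auto simp: T_def image_iff)
    next
      fix d y assume "y \<in> T"
      then obtain c s where "y = c \<star> x + s" "s \<in> S" by (auto simp: T_def)
      then have "d \<star> y = (d * c) \<star> x + d \<star> s" "d \<star> s \<in> S"
        using k(1) by (auto simp: algebra_simps subspace_scale)
      then show "d \<star> y \<in> T" by (auto simp: T_def image_iff)
    qed
    ultimately have "T \<in> A" unfolding A_def by blast
    moreover have "S \<subseteq> T"
    proof
      fix s assume "s \<in> S"
      then have "s = 0 \<star> x + s" by simp
      then show "s \<in> T" using \<open>s \<in> S\<close> unfolding T_def by (metis (no_types, lifting) SigmaI UNIV_I case_prod_conv image_eqI)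
    qed
    ultimately have "S = T" using S(2) by blast
    have "x = 1 \<star> x + 0" by simp
    then have "x \<in> T"
      unfolding T_def using subspace_0[OF k(1)] by (metis (no_types, lifting) SigmaI UNIV_I case_prod_conv image_eqI)
    then show False using x \<open>S = T\<close> by simp
  qed
  then show thesis using that[of k] k by auto
qed

section \<open>Level sets, anisotropic lines and hyperbolic planes\<close>

text \<open>Translation along a vector \<open>y\<close> with \<open>B y u = 1\<close> moves between
  the level sets of \<open>u\<close>, so all q of them have the same size.\<close>

lemma card_level_set:
  assumes "nondeg U" "u \<in> U" "u \<noteq> 0"
  shows "card {x \<in> U. B x u = c} * CARD('a) = card U"
proof -
  have U: "subspace U" using assms nondegD by simp
  obtain z where z: "z \<in> U" "B u z \<noteq> 0" using assms by (auto simp: nondeg_def)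
  define y where "y = inverse (B u z) \<star> z"
  have y: "y \<in> U" "B y u = 1"
    using z U sym[of z u] by (auto simp: y_def subspace_scale scale_left)
  have "bij_betw (\<lambda>(t, x). t \<star> y + x) (UNIV \<times> {x \<in> U. B x u = c}) U"
    by (rule bij_betw_byWitness[where f' = "\<lambda>w. (B w u - c, w - (B w u - c) \<star> y)"])
       (use U y in \<open>auto simp: B_simps intro!: subspace_add subspace_diff subspace_scale\<close>)
  then have "card ((UNIV :: 'a set) \<times> {x \<in> U. B x u = c}) = card U"
    by (rule bij_betw_same_card)
  then show ?thesis by (simp add: card_cartesian_product mult.commute)
qed

text \<open>By polarisation, a form with \<open>B x x = 0\<close> throughout is zero when 2 is
  invertible.\<close>

lemma exists_anisotropic:
  assumes "nondeg U" "card U \<noteq> 1"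
  obtains x where "x \<in> U" "B x x \<noteq> 0"
proof (rule ccontr)
  assume "\<not> thesis"
  then have *: "B x x = 0" if "x \<in> U" for x using that \<open>\<And>x. x \<in> U \<Longrightarrow> B x x \<noteq> 0 \<Longrightarrow> thesis\<close> by blast
  have "B x y = 0" if "x \<in> U" "y \<in> U" for x y
  proof -
    have "B (x + y) (x + y) = 0"
      using * that nondegD[OF assms(1)] subspace_add by blast
    then have "2 * B x y = 0"
      using *[OF that(1)] *[OF that(2)] sym[of y x] by (simp add: B_simps)
    then show ?thesis using two_neq_0 by simp
  qed
  then have "U \<subseteq> {0}" using assms(1) by (auto simp: nondeg_def)
  then have "U = {0}" using subspace_0 nondegD[OF assms(1)] by blast
  then show False using assms(2) by simp
qed

lemma line_subspace: "subspace (range (\<lambda>c. c \<star> x))"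
proof (rule subspaceI)
  show "0 \<in> range (\<lambda>c. c \<star> x)" by (auto simp: image_iff intro!: exI[of _ 0])
qed (auto simp: image_iff simp flip: scale_left_distrib intro: exI)

lemma card_line:
  assumes "x \<noteq> 0"
  shows "card (range (\<lambda>c. c \<star> x)) = CARD('a)"
  by (rule card_image) (use assms in \<open>auto intro!: injI\<close>)

lemma line_in_splits:
  assumes "subspace U" "x \<in> U" "B x x \<noteq> 0"
  shows "range (\<lambda>c. c \<star> x) \<in> splits U"
  unfolding splits_def mem_Collect_eq
proof (intro conjI ballI)
  show "range (\<lambda>c. c \<star> x) \<subseteq> U" using assms subspace_scale by blast
next
  fix y assume "y \<in> U"
  then have "y - (B y x / B x x) \<star> x \<in> perp U (range (\<lambda>c. c \<star> x))"
    using assms by (auto simp: perp_def B_simps subspace_diff subspace_scale)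
  then show "\<exists>a\<in>range (\<lambda>c. c \<star> x). y - a \<in> perp U (range (\<lambda>c. c \<star> x))" by blast
qed (rule line_subspace)

definition plane :: "'v \<Rightarrow> 'v \<Rightarrow> 'v set" where
  "plane u v = range (\<lambda>(a, b). a \<star> u + b \<star> v)"

lemma plane_in_splits:
  assumes "subspace U" "(u, v) \<in> hyperbolic_pairs U"
  shows "plane u v \<in> splits U"
    and "perp U (plane u v) = {x \<in> U. B x u = 0 \<and> B x v = 0}"
    and "card (plane u v) = CARD('a) ^ 2"
proof -
  have uv: "u \<in> U" "v \<in> U" "B u u = 0" "B v v = 0" "B u v = 1" "B v u = 1"
    using assms(2) sym[of u v] by (auto simp: hyperbolic_pairs_def singular_def partners_def)
  have mem: "a \<star> u + b \<star> v \<in> plane u v" for a b by (force simp: plane_def)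
  have uvp: "u \<in> plane u v" "v \<in> plane u v" using mem[of 1 0] mem[of 0 1] by auto
  show perp: "perp U (plane u v) = {x \<in> U. B x u = 0 \<and> B x v = 0}"
  proof (rule equalityI)
    show "perp U (plane u v) \<subseteq> {x \<in> U. B x u = 0 \<and> B x v = 0}"
      using uvp by (auto simp: perp_def)
    show "{x \<in> U. B x u = 0 \<and> B x v = 0} \<subseteq> perp U (plane u v)"
      by (auto simp: perp_def plane_def B_simps)
  qed
  show "plane u v \<in> splits U"
    unfolding splits_def mem_Collect_eq
  proof (intro conjI ballI)
    show "subspace (plane u v)"
    proof (rule subspaceI)
      show "0 \<in> plane u v" using mem[of 0 0] by simp
    next
      fix x y assume "x \<in> plane u v" "y \<in> plane u v"
      then obtain a b a' b' where "x = a \<star> u + b \<star> v" "y = a' \<star> u + b' \<star> v"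
        by (auto simp: plane_def)
      then have "x + y = (a + a') \<star> u + (b + b') \<star> v" by (simp add: algebra_simps)
      then show "x + y \<in> plane u v" using mem by simp
    next
      fix c x assume "x \<in> plane u v"
      then obtain a b where "x = a \<star> u + b \<star> v" by (auto simp: plane_def)
      then have "c \<star> x = (c * a) \<star> u + (c * b) \<star> v" by (simp add: algebra_simps)
      then show "c \<star> x \<in> plane u v" using mem by simp
    qed
    show "plane u v \<subseteq> U"
      using uv assms(1) by (auto simp: plane_def subspace_add subspace_scale)
  next
    fix x assume "x \<in> U"
    \<comment> \<open>The coefficients are crossed because \<open>u\<close> and \<open>v\<close> are
      dual to each other: pairing with \<open>v\<close> reads off the coefficient of
      \<open>u\<close>, and conversely.\<close>
    then have "x - (B x v \<star> u + B x u \<star> v) \<in> perp U (plane u v)"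
      unfolding perp using uv assms(1) by (auto simp: B_simps intro!: subspace_diff subspace_add subspace_scale)
    then show "\<exists>a\<in>plane u v. x - a \<in> perp U (plane u v)" using mem by blast
  qed
  have "inj (\<lambda>(a, b). a \<star> u + b \<star> v)"
  proof (intro injI; clarify)
    fix a b a' b' assume *: "a \<star> u + b \<star> v = a' \<star> u + b' \<star> v"
    have "B (a \<star> u + b \<star> v) u = B (a' \<star> u + b' \<star> v) u"
      "B (a \<star> u + b \<star> v) v = B (a' \<star> u + b' \<star> v) v" using * by simp_all
    then show "a = a' \<and> b = b'" using uv by (simp add: B_simps)
  qed
  from card_image[OF this] show "card (plane u v) = CARD('a) ^ 2"
    by (simp add: plane_def card_prod power2_eq_square)
qed

section \<open>Singular vectors and hyperbolic pairs\<close>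

text \<open>Pigeonhole: \<open>a * s\<^sup>2\<close> and \<open>c - b * t\<^sup>2\<close> each take
  more than half of all values, so they share one.\<close>

lemma binary_form_represents:
  fixes a b c :: 'a
  assumes "a \<noteq> 0" "b \<noteq> 0"
  obtains s t where "a * s\<^sup>2 + b * t\<^sup>2 = c"
proof -
  \<comment> \<open>Fibres have at most two elements, and equality is impossible because q is odd;
    the constant \<open>d\<close> lets one statement serve both polynomials.\<close>
  have half: "CARD('a) < 2 * card (range f)"
    if f: "f = (\<lambda>s. d + a * s\<^sup>2)" "a \<noteq> 0" for f :: "'a \<Rightarrow> 'a" and a d
  proof -
    have "UNIV = (\<Union>y\<in>range f. {s. f s = y})" by auto
    then have "CARD('a) \<le> (\<Sum>y\<in>range f. card {s. f s = y})"
      by (metis card_UN_le finite_code)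
    also have "\<dots> \<le> (\<Sum>y\<in>range f. 2)"
    proof (rule sum_mono)
      fix y assume "y \<in> range f"
      then obtain s where "y = f s" by auto
      then have "{s. f s = y} = {s, - s}"
        using f by (auto simp: power2_eq_iff)
      then show "card {s. f s = y} \<le> 2"
        by (simp add: card_insert_if)
    qed
    finally have "CARD('a) \<le> 2 * card (range f)" by simp
    moreover have "CARD('a) \<noteq> 2 * card (range f)" using odd_card by (metis dvd_triv_left)
    ultimately show ?thesis by simp
  qed
  let ?f = "\<lambda>s. 0 + a * s\<^sup>2" and ?g = "\<lambda>s. c + (- b) * s\<^sup>2"
  have "range ?f \<inter> range ?g \<noteq> {}"
  proof
    assume "range ?f \<inter> range ?g = {}"
    then have "card (range ?f) + card (range ?g) = card (range ?f \<union> range ?g)"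
      by (simp add: card_Un_disjoint)
    also have "\<dots> \<le> CARD('a)" by (rule card_mono) auto
    finally show False using half[of ?f 0 a] half[of ?g c "- b"] assms by auto
  qed
  then obtain s t where "0 + a * s\<^sup>2 = c + (- b) * t\<^sup>2" by blast
  then have "a * s\<^sup>2 + b * t\<^sup>2 = c" by (simp add: algebra_simps)
  then show thesis using that by blast
qed

text \<open>Dimension at least three provides three mutually orthogonal anisotropic vectors, and the
  form on the first two represents the negative of the value at the third.\<close>

lemma exists_singular:
  assumes "nondeg U" "card U = CARD('a) ^ (k + 3)"
  obtains u where "u \<in> singular U" "u \<noteq> 0"
proof -
  let ?L = "\<lambda>x. range (\<lambda>c. c \<star> x)"
  have step: "\<exists>x\<in>W. B x x \<noteq> 0 \<and> nondeg (perp W (?L x)) \<and> card (perp W (?L x)) = CARD('a) ^ j"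
    if W: "nondeg W" "card W = CARD('a) ^ Suc j" for W j
  proof -
    have "1 < CARD('a) ^ Suc j" using CARD_gt_1 by (intro one_less_power) auto
    then have "card W \<noteq> 1" by (metis W(2) less_irrefl)
    then obtain x where x: "x \<in> W" "B x x \<noteq> 0" using exists_anisotropic[OF W(1)] by blast
    then have L: "?L x \<in> splits W" using line_in_splits W nondegD by blast
    moreover have "x \<noteq> 0" using x by auto
    ultimately have "CARD('a) * card (perp W (?L x)) = CARD('a) ^ Suc j"
      using card_splits[OF W(1)] card_line W(2) by metis
    then have "card (perp W (?L x)) = CARD('a) ^ j" using CARD_gt_1 by simp
    then show ?thesis using x nondeg_perp[OF W(1) L] by blast
  qed
  have cU: "card U = CARD('a) ^ Suc (k + 2)"
    using assms(2) by (simp add: eval_nat_numeral)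
  obtain x where x: "x \<in> U" "B x x \<noteq> 0" "nondeg (perp U (?L x))"
    "card (perp U (?L x)) = CARD('a) ^ (k + 2)"
    using step[OF assms(1) cU] by blast
  define U1 where "U1 = perp U (?L x)"
  obtain y where y: "y \<in> U1" "B y y \<noteq> 0" "nondeg (perp U1 (?L y))"
    "card (perp U1 (?L y)) = CARD('a) ^ (k + 1)"
    using step[OF x(3), of "k + 1"] x(4) by (auto simp: U1_def)
  define U2 where "U2 = perp U1 (?L y)"
  obtain z where z: "z \<in> U2" "B z z \<noteq> 0"
    using step[OF y(3), of k] y(4) by (auto simp: U2_def)
  have z1: "z \<in> U1" using z perp_subset by (auto simp: U2_def)
  have inU: "y \<in> U" "z \<in> U" using z1 y perp_subset by (auto simp: U1_def)
  have orth: "B w x = 0" if "w \<in> U1" for w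
  proof -
    have "B w (1 \<star> x) = 0" using that unfolding U1_def perp_def by blast
    then show ?thesis by simp
  qed
  have "B z (1 \<star> y) = 0" using z(1) unfolding U2_def perp_def by blast
  then have o: "B y x = 0" "B z x = 0" "B z y = 0" "B x y = 0" "B x z = 0" "B y z = 0"
    using orth y(1) z1 sym by (metis scale_one)+
  obtain s t where st: "B x x * s\<^sup>2 + B y y * t\<^sup>2 = - B z z"
    using binary_form_represents x(2) y(2) by metis
  \<comment> \<open>The coefficient 1 of \<open>z\<close> guarantees that \<open>w\<close> is
    nonzero, even if \<open>s\<close> and \<open>t\<close> both vanish.\<close>
  define w where "w = s \<star> x + t \<star> y + z"
  have "B w w = B x x * s\<^sup>2 + B y y * t\<^sup>2 + B z z"
    by (simp add: w_def B_simps o power2_eq_square)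
  then have "B w w = 0" using st by simp
  moreover have "w \<in> U"
    using x(1) inU nondegD[OF assms(1)] by (auto simp: w_def intro!: subspace_add subspace_scale)
  moreover have "B w z = B z z" by (simp add: w_def B_simps o)
  then have "w \<noteq> 0" using z(2) by auto
  ultimately show thesis using that by (auto simp: singular_def)
qed

text \<open>Moving a vector \<open>x\<close> with \<open>B x u = 1\<close> along the singular
  \<open>u\<close> keeps \<open>B x u\<close> and changes \<open>B x x\<close> by twice the step, so
  each line in this direction contains exactly one partner.\<close>

lemma card_partners:
  assumes "nondeg U" "u \<in> singular U" "u \<noteq> 0"
  shows "card (partners U u) * CARD('a) ^ 2 = card U"
proof -
  have U: "subspace U" and u: "u \<in> U" "B u u = 0"
    using assms nondegD by (auto simp: singular_def)
  have "bij_betw (\<lambda>(t, v). t \<star> u + v) (UNIV \<times> partners U u) {x \<in> U. B x u = 1}"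
  proof (rule bij_betw_byWitness[where f' = "\<lambda>x. (B x x / 2, x - (B x x / 2) \<star> u)"])
    show "\<forall>p\<in>UNIV \<times> partners U u.
        (\<lambda>x. (B x x / 2, x - (B x x / 2) \<star> u)) ((\<lambda>(t, v). t \<star> u + v) p) = p"
    proof -
      have "B (t \<star> u + v) (t \<star> u + v) / 2 = t" if v: "v \<in> partners U u" for t v
      proof -
        have "B u v = 1" using v by (simp add: partners_def sym[of u v])
        then have "B (t \<star> u + v) (t \<star> u + v) = 2 * t"
          using u v by (simp add: partners_def B_simps)
        then show ?thesis using two_neq_0 by simp
      qed
      then show ?thesis by auto
    qed
    show "(\<lambda>(t, v). t \<star> u + v) ` (UNIV \<times> partners U u) \<subseteq> {x \<in> U. B x u = 1}"
      using u U by (auto simp: partners_def B_simps subspace_add subspace_scale)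
    show "(\<lambda>x. (B x x / 2, x - (B x x / 2) \<star> u)) ` {x \<in> U. B x u = 1} \<subseteq> UNIV \<times> partners U u"
    proof (clarsimp simp: partners_def)
      fix x assume x: "x \<in> U" "B x u = 1"
      define t where "t = B x x / 2"
      have "B u x = 1" "B x x = t + t" using x sym[of u x] two_neq_0 by (auto simp: t_def)
      then show "x - t \<star> u \<in> U \<and> B (x - t \<star> u) (x - t \<star> u) = 0 \<and> B (x - t \<star> u) u = 1"
        using x u U by (simp add: B_simps subspace_diff subspace_scale)
    qed
  qed auto
  then have "card ((UNIV :: 'a set) \<times> partners U u) = card {x \<in> U. B x u = 1}"
    by (rule bij_betw_same_card)
  then have "CARD('a) * card (partners U u) = card {x \<in> U. B x u = 1}"
    by (simp only: card_cartesian_product)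
  then show ?thesis
    using card_level_set[OF assms(1) u(1) assms(3), of 1]
    by (simp add: power2_eq_square mult.commute mult.left_commute)
qed

text \<open>Splitting off a hyperbolic plane lowers the dimension by two. In odd dimension the
  descent ends at an anisotropic line, whose only singular vector is 0, so no type of form enters
  the count.\<close>

lemma card_singular:
  assumes "nondeg U" "card U = CARD('a) ^ (2 * n + 1)"
  shows "card (singular U) = CARD('a) ^ (2 * n)"
  using assms
proof (induction n arbitrary: U)
  case 0
  then have "card U \<noteq> 1" using CARD_gt_1 by simp
  then obtain x where x: "x \<in> U" "B x x \<noteq> 0" using exists_anisotropic[OF 0(1)] by blast
  then have "x \<noteq> 0" by auto
  have "range (\<lambda>c. c \<star> x) = U"
  proof (rule card_subset_eq)
    show "finite U" using 0 nondegD by blast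
    show "range (\<lambda>c. c \<star> x) \<subseteq> U" using x 0 nondegD subspace_scale by blast
    show "card (range (\<lambda>c. c \<star> x)) = card U" using card_line[OF \<open>x \<noteq> 0\<close>] 0 by simp
  qed
  then have "singular U = {0}"
    using x subspace_0 nondegD[OF 0(1)] by (auto simp: singular_def B_simps)
  then show ?case by simp
next
  case (Suc n)
  have U: "subspace U" "finite U" using Suc nondegD by auto
  have "card U = CARD('a) ^ (2 * n + 3)" using Suc.prems by (simp add: eval_nat_numeral)
  then obtain u where u: "u \<in> singular U" "u \<noteq> 0" using exists_singular[OF Suc.prems(1)] by metis
  have "card (partners U u) * CARD('a) ^ 2 = card U" using card_partners[OF Suc.prems(1) u] .
  then have "partners U u \<noteq> {}" using Suc.prems(2) by force
  then obtain v where v: "v \<in> partners U u" by blast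
  then have uv: "(u, v) \<in> hyperbolic_pairs U" using u by (simp add: hyperbolic_pairs_def)
  have uv': "u \<in> U" "v \<in> U" "B u u = 0" "B v v = 0" "B u v = 1" "B v u = 1"
    using u v sym[of u v] by (auto simp: singular_def partners_def)
  define W where "W = perp U (plane u v)"
  note pl = plane_in_splits[OF U(1) uv]
  have W: "nondeg W" using nondeg_perp[OF Suc.prems(1) pl(1)] by (simp add: W_def)
  have "CARD('a) ^ 2 * card W = CARD('a) ^ 2 * CARD('a) ^ (2 * n + 1)"
    using card_splits[OF Suc.prems(1) pl(1)] Suc.prems(2) pl(3) by (simp add: W_def eval_nat_numeral)
  then have cW: "card W = CARD('a) ^ (2 * n + 1)" by simp
  have W_iff: "x \<in> W \<longleftrightarrow> x \<in> U \<and> B x u = 0 \<and> B x v = 0" for x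
    using pl(2) by (simp add: W_def)
  have W_sym: "B u x = 0" "B v x = 0" if "x \<in> W" for x
    using that sym W_iff by metis+
  \<comment> \<open>For x = a u + b v + w one has \<open>B x x\<close> = 2ab + \<open>B w w\<close>.
    If b is nonzero, singularity determines a from b and an arbitrary w in \<open>W\<close>.\<close>
  have "bij_betw (\<lambda>(b, w). (- (B w w / (2 * b))) \<star> u + b \<star> v + w)
      ((UNIV - {0}) \<times> W) {x \<in> singular U. B x u \<noteq> 0}"
  proof (rule bij_betw_byWitness[where f' = "\<lambda>x. (B x u, x - (B x v \<star> u + B x u \<star> v))"])
    show "\<forall>p\<in>(UNIV - {0}) \<times> W. (\<lambda>x. (B x u, x - (B x v \<star> u + B x u \<star> v)))
        ((\<lambda>(b, w). (- (B w w / (2 * b))) \<star> u + b \<star> v + w) p) = p"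
      using uv' by (auto simp: B_simps W_iff)
    show "\<forall>x\<in>{x \<in> singular U. B x u \<noteq> 0}. (\<lambda>(b, w). (- (B w w / (2 * b))) \<star> u + b \<star> v + w)
        (B x u, x - (B x v \<star> u + B x u \<star> v)) = x"
    proof clarify
      fix x assume x: "x \<in> singular U" "B x u \<noteq> 0"
      define w where "w = x - (B x v \<star> u + B x u \<star> v)"
      have "B w w = - (2 * B x u * B x v)"
        using x(1) uv' sym[of u x] sym[of v x] by (simp add: w_def B_simps singular_def algebra_simps)
      then have "- (B w w / (2 * B x u)) = B x v" using x(2) two_neq_0 by (simp add: divide_simps)
      then show "- (B (x - (B x v \<star> u + B x u \<star> v)) (x - (B x v \<star> u + B x u \<star> v)) / (2 * B x u)) \<star> u +
        B x u \<star> v + (x - (B x v \<star> u + B x u \<star> v)) = x"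
        unfolding w_def[symmetric] by (simp add: w_def)
    qed
    show "(\<lambda>(b, w). (- (B w w / (2 * b))) \<star> u + b \<star> v + w) ` ((UNIV - {0}) \<times> W)
        \<subseteq> {x \<in> singular U. B x u \<noteq> 0}"
    proof (rule image_subsetI, unfold split_paired_all prod.case)
      fix b :: 'a and w assume "(b, w) \<in> (UNIV - {0}) \<times> W"
      then have *: "w \<in> W" "b \<noteq> 0" by auto
      let ?x = "(- (B w w / (2 * b))) \<star> u + b \<star> v + w"
      have "?x \<in> U" using * W_iff U uv' by (intro subspace_add subspace_scale) auto
      moreover have "B ?x u = b" using uv' * W_iff by (simp add: B_simps)
      moreover have "B ?x ?x = 0"
        using uv' * W_iff W_sym two_neq_0 by (simp add: B_simps field_simps)
      ultimately show "?x \<in> {x \<in> singular U. B x u \<noteq> 0}" using *(2) by (simp add: singular_def)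
    qed
    show "(\<lambda>x. (B x u, x - (B x v \<star> u + B x u \<star> v))) ` {x \<in> singular U. B x u \<noteq> 0}
        \<subseteq> (UNIV - {0}) \<times> W"
      using uv' by (auto simp: singular_def W_iff B_simps
          intro!: subspace_diff[OF U(1)] subspace_add[OF U(1)] subspace_scale[OF U(1)])
  qed
  from bij_betw_same_card[OF this]
  have c1: "card {x \<in> singular U. B x u \<noteq> 0} = (CARD('a) - 1) * CARD('a) ^ (2 * n + 1)"
    by (simp add: card_cartesian_product card_Diff_singleton cW)
  have su: "B u x = 0" if "B x u = 0" for x using that sym[of u x] by simp
  \<comment> \<open>If b = 0, singularity of x is that of w, and a is free.\<close>
  have "bij_betw (\<lambda>(a, w). a \<star> u + w) (UNIV \<times> singular W) {x \<in> singular U. B x u = 0}"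
  proof (rule bij_betw_byWitness[where f' = "\<lambda>x. (B x v, x - B x v \<star> u)"])
    show "\<forall>p\<in>UNIV \<times> singular W.
        (\<lambda>x. (B x v, x - B x v \<star> u)) ((\<lambda>(a, w). a \<star> u + w) p) = p"
      using uv' by (auto simp: singular_def W_iff B_simps)
    show "(\<lambda>(a, w). a \<star> u + w) ` (UNIV \<times> singular W) \<subseteq> {x \<in> singular U. B x u = 0}"
    proof (rule image_subsetI, unfold split_paired_all prod.case)
      fix a :: 'a and w assume "(a, w) \<in> UNIV \<times> singular W"
      then have w: "w \<in> U" "B w u = 0" "B u w = 0" "B w w = 0"
        using su by (auto simp: singular_def W_iff)
      then have "a \<star> u + w \<in> U" using U(1) uv'(1) subspace_add subspace_scale by blast
      then show "a \<star> u + w \<in> {x \<in> singular U. B x u = 0}"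
        using w uv'(3) by (simp add: singular_def B_simps)
    qed
    show "(\<lambda>x. (B x v, x - B x v \<star> u)) ` {x \<in> singular U. B x u = 0} \<subseteq> UNIV \<times> singular W"
    proof (rule image_subsetI)
      fix x assume "x \<in> {x \<in> singular U. B x u = 0}"
      then have x: "x \<in> U" "B x x = 0" "B x u = 0" "B u x = 0"
        using su by (auto simp: singular_def)
      then have "x - B x v \<star> u \<in> U" using U(1) uv'(1) subspace_diff subspace_scale by blast
      then show "(B x v, x - B x v \<star> u) \<in> UNIV \<times> singular W"
        using x uv' by (simp add: singular_def W_iff B_simps)
    qed
  qed auto
  from bij_betw_same_card[OF this]
  have c2: "card {x \<in> singular U. B x u = 0} = CARD('a) * CARD('a) ^ (2 * n)"
    by (simp add: card_cartesian_product Suc.IH[OF W cW])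
  have "singular U = {x \<in> singular U. B x u \<noteq> 0} \<union> {x \<in> singular U. B x u = 0}" by auto
  also have "card \<dots> = card {x \<in> singular U. B x u \<noteq> 0} + card {x \<in> singular U. B x u = 0}"
    by (rule card_Un_disjoint) (use U in \<open>auto simp: singular_def\<close>)
  also have "\<dots> = (CARD('a) - 1 + 1) * CARD('a) ^ (2 * n + 1)"
    unfolding c1 c2 by (simp add: algebra_simps)
  also have "\<dots> = CARD('a) ^ (2 * Suc n)" using CARD_gt_1 by (simp add: eval_nat_numeral)
  finally show ?case .
qed

text \<open>Every nonzero singular vector has the same number of partners. The factor
  \<open>CARD('a)\<close> on the left avoids the exponent 2n-1, which would be truncated at
  \<open>n = 0\<close>.\<close>

lemma card_hyperbolic_pairs:
  assumes "nondeg U" "card U = CARD('a) ^ (2 * n + 1)"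
  shows "card (hyperbolic_pairs U) * CARD('a) = (CARD('a) ^ (2 * n) - 1) * CARD('a) ^ (2 * n)"
proof -
  have U: "subspace U" "finite U" using assms nondegD by auto
  have fin: "finite (singular U)" "finite (partners U u)" for u
    using U(2) by (auto simp: singular_def partners_def)
  have p: "card (partners U u) * CARD('a) = CARD('a) ^ (2 * n)" if "u \<in> singular U - {0}" for u
  proof -
    have "card (partners U u) * CARD('a) * CARD('a) = CARD('a) ^ (2 * n) * CARD('a)"
      using card_partners[OF assms(1), of u] that assms(2) by (simp add: power2_eq_square mult.assoc)
    then show ?thesis by simp
  qed
  have "hyperbolic_pairs U = (SIGMA u : singular U - {0}. partners U u)"
    by (auto simp: hyperbolic_pairs_def partners_def)
  then have "card (hyperbolic_pairs U) = (\<Sum>u\<in>singular U - {0}. card (partners U u))"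
    using fin by (simp add: card_SigmaI)
  then have "card (hyperbolic_pairs U) * CARD('a) = (\<Sum>u\<in>singular U - {0}. CARD('a) ^ (2 * n))"
    using p by (simp add: sum_distrib_right)
  also have "\<dots> = (CARD('a) ^ (2 * n) - 1) * CARD('a) ^ (2 * n)"
    using card_singular[OF assms] subspace_0[OF U(1)] fin by (simp add: singular_def)
  finally show ?thesis .
qed

section \<open>Double counting of splitting subspaces\<close>

text \<open>The exchange behind the double count: fixing \<open>M\<close> leaves pairs in its
  complement, fixing the pair leaves subspaces splitting the complement of its plane. For the
  converse direction, the plane itself lies in the complement of \<open>M\<close> and is absorbed
  there.\<close>

lemma splits_orthogonal_iff:
  assumes "subspace U" "(u, v) \<in> hyperbolic_pairs U"
  shows "M \<in> splits U \<and> (u, v) \<in> hyperbolic_pairs (perp U M) \<longleftrightarrow> M \<in> splits (perp U (plane u v))"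
    (is "?L \<longleftrightarrow> M \<in> splits ?W")
proof -
  have uv: "u \<in> U" "v \<in> U" "B u u = 0" "B v v = 0" "B u v = 1" "B v u = 1"
    using assms(2) sym[of u v] by (auto simp: hyperbolic_pairs_def singular_def partners_def)
  note pl = plane_in_splits[OF assms]
  have W_iff: "x \<in> ?W \<longleftrightarrow> x \<in> U \<and> B x u = 0 \<and> B x v = 0" for x
    using pl(2) by simp
  have hyp_iff: "(u, v) \<in> hyperbolic_pairs (perp U M) \<longleftrightarrow> (\<forall>y\<in>M. B y u = 0 \<and> B y v = 0)"
    using uv sym by (auto simp: hyperbolic_pairs_def singular_def partners_def perp_def)
  show ?thesis
  proof
    assume ?L
    then have M: "subspace M" "M \<subseteq> U" "M \<in> splits U" "\<forall>y\<in>M. B y u = 0 \<and> B y v = 0"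
      using hyp_iff by (auto simp: splits_def)
    have "\<exists>a\<in>M. x - a \<in> perp ?W M" if x: "x \<in> ?W" for x
    proof -
      have "x \<in> U" using x W_iff by blast
      then obtain a b where ab: "a \<in> M" "b \<in> perp U M" "x = a + b"
        using splitsE[OF M(3)] by metis
      have "b \<in> U" "B b u = B x u - B a u" "B b v = B x v - B a v"
        using ab by (auto simp: perp_def B_simps)
      then have "b \<in> ?W" using x ab(1) M(4) W_iff by simp
      then have "b \<in> perp ?W M" using ab(2) by (auto simp: perp_def)
      then show ?thesis using ab by (intro bexI[of _ a]) auto
    qed
    moreover have "M \<subseteq> ?W" using M W_iff by blast
    ultimately show "M \<in> splits ?W" using M(1) by (auto simp: splits_def)
  next
    assume "M \<in> splits ?W"
    then have M: "subspace M" "M \<subseteq> ?W" "M \<in> splits ?W" by (auto simp: splits_def)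
    then have orth: "B y u = 0 \<and> B y v = 0" "B u y = 0 \<and> B v y = 0" if "y \<in> M" for y
      using that W_iff sym by (blast, metis in_mono)
    have "\<exists>a\<in>M. x - a \<in> perp U M" if x: "x \<in> U" for x
    proof -
      obtain p w where pw: "p \<in> plane u v" "w \<in> ?W" "x = p + w"
        using splitsE[OF pl(1) x] .
      obtain a b where ab: "a \<in> M" "b \<in> perp ?W M" "w = a + b"
        using splitsE[OF M(3) pw(2)] .
      obtain r s where "p = r \<star> u + s \<star> v" using pw(1) by (auto simp: plane_def)
      then have "p \<in> perp U M"
        using uv orth assms(1) by (auto simp: perp_def B_simps subspace_add subspace_scale)
      moreover have "b \<in> perp U M" using ab(2) W_iff by (auto simp: perp_def)
      ultimately have "p + b \<in> perp U M"
        using subspace_perp[OF assms(1)] subspace_add by blast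
      then show ?thesis using ab pw by (intro bexI[of _ a]) (auto simp: algebra_simps)
    qed
    then show ?L
      using M W_iff orth hyp_iff by (auto simp: splits_def)
  qed
qed

text \<open>The value \<open>f\<close> must be common to all nondegenerate spaces of the smaller
  size, because complements of different planes are compared by cardinality alone; correspondingly
  the induction below quantifies over all \<open>U\<close>.\<close>

lemma double_count_hyperbolic_pairs:
  assumes U: "nondeg U"
    and h: "\<And>W. nondeg W \<Longrightarrow> card W * CARD('a) ^ 2 = card U \<Longrightarrow> real (card (splits_of_dim W k)) = f"
    and g: "\<And>M. M \<in> splits_of_dim U k \<Longrightarrow> real (card (hyperbolic_pairs (perp U M))) = g"
  shows "real (card (splits_of_dim U k)) * g = real (card (hyperbolic_pairs U)) * f"
proof -
  have sU: "subspace U" "finite U" using U nondegD by auto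
  have finS: "finite (splits_of_dim W j)" if "finite W" for W j
    by (rule finite_subset[of _ "Pow W"]) (use that in \<open>auto simp: splits_of_dim_def splits_def\<close>)
  have finH: "finite (hyperbolic_pairs W)" if "finite W" for W
    by (rule finite_subset[of _ "W \<times> W"])
       (use that in \<open>auto simp: hyperbolic_pairs_def singular_def partners_def\<close>)
  have finP: "finite (perp U M)" for M using sU perp_subset finite_subset by metis
  let ?D1 = "SIGMA M : splits_of_dim U k. hyperbolic_pairs (perp U M)"
  let ?D2 = "SIGMA p : hyperbolic_pairs U. splits_of_dim (perp U (plane (fst p) (snd p))) k"
  have "bij_betw prod.swap ?D1 ?D2"
  proof (rule bij_betw_imageI)
    have sub: "hyperbolic_pairs (perp U M) \<subseteq> hyperbolic_pairs U" for M
      by (auto simp: hyperbolic_pairs_def singular_def partners_def perp_def)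
    have "(M, p) \<in> ?D1 \<longleftrightarrow> (p, M) \<in> ?D2" for M p
    proof (cases "p \<in> hyperbolic_pairs U")
      case True
      then show ?thesis
        using splits_orthogonal_iff[OF sU(1), of "fst p" "snd p" M] by (auto simp: splits_of_dim_def)
    next
      case False
      then show ?thesis using sub by auto
    qed
    then show "prod.swap ` ?D1 = ?D2" by (auto simp: image_iff) force+
  qed (auto intro: inj_onI)
  then have "card ?D1 = card ?D2" by (rule bij_betw_same_card)
  moreover have "real (card ?D1) = real (card (splits_of_dim U k)) * g"
    using finS[OF sU(2)] finH finP g by (simp add: card_SigmaI)
  moreover have "real (card (splits_of_dim (perp U (plane (fst p) (snd p))) k)) = f"
    if p: "p \<in> hyperbolic_pairs U" for p
  proof (rule h)
    have p': "(fst p, snd p) \<in> hyperbolic_pairs U" using p by simp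
    show "nondeg (perp U (plane (fst p) (snd p)))"
      using nondeg_perp[OF U plane_in_splits(1)[OF sU(1) p']] .
    show "card (perp U (plane (fst p) (snd p))) * CARD('a) ^ 2 = card U"
      using card_splits[OF U plane_in_splits(1)[OF sU(1) p']] plane_in_splits(3)[OF sU(1) p']
      by (simp add: mult.commute)
  qed
  then have "real (card ?D2) = real (card (hyperbolic_pairs U)) * f"
    using finS finH[OF sU(2)] finP by (simp add: card_SigmaI)
  ultimately show ?thesis by metis
qed

lemma bij_betw_perp:
  assumes "nondeg U" "card U = CARD('a) ^ (i + j)"
  shows "bij_betw (perp U) (splits_of_dim U i) (splits_of_dim U j)"
proof -
  have *: "perp U M \<in> splits_of_dim U b"
    if "M \<in> splits_of_dim U a" "card U = CARD('a) ^ (a + b)" for M a b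
  proof -
    have M: "M \<in> splits U" "card M = CARD('a) ^ a" using that by (auto simp: splits_of_dim_def)
    have "CARD('a) ^ a * card (perp U M) = CARD('a) ^ a * CARD('a) ^ b"
      using card_splits[OF assms(1) M(1)] M(2) that(2) by (simp add: power_add)
    then show ?thesis using perp_in_splits[OF assms(1) M(1)] by (simp add: splits_of_dim_def)
  qed
  show ?thesis
  proof (rule bij_betw_byWitness[where f' = "perp U"])
    show "perp U ` splits_of_dim U i \<subseteq> splits_of_dim U j"
      using * assms(2) by blast
    show "perp U ` splits_of_dim U j \<subseteq> splits_of_dim U i"
      using *[of _ j i] assms(2) by (auto simp: add.commute)
  qed (auto simp: splits_of_dim_def perp_perp[OF assms(1)])
qed

text \<open>The splitting lines are the anisotropic ones, and without 0 they partition the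
  nonsingular vectors into classes of size q-1.\<close>

lemma card_splits_of_dim_1:
  assumes "nondeg U" "card U = CARD('a) ^ (2 * n + 1)"
  shows "card (splits_of_dim U 1) = CARD('a) ^ (2 * n)"
proof -
  have U: "subspace U" "finite U" using assms nondegD by auto
  let ?F = "splits_of_dim U 1" and ?L = "\<lambda>x. range (\<lambda>c. c \<star> x)"
  have F: "M = ?L x \<and> B x x \<noteq> 0" if M: "M \<in> ?F" and x: "x \<in> M - {0}" for M x
  proof -
    have M': "M \<in> splits U" "subspace M" "M \<subseteq> U" "card M = CARD('a)"
      using M by (auto simp: splits_of_dim_def splits_def)
    have "?L x \<subseteq> M" using x M'(2) subspace_scale by blast
    moreover have "finite M" using M'(3) U(2) finite_subset by blast
    moreover have "card (?L x) = card M" using x card_line M'(4) by simp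
    ultimately have L: "?L x = M" using card_subset_eq by blast
    have "B x x \<noteq> 0"
    proof
      assume "B x x = 0"
      then have "x \<in> perp U M"
        using x M'(3) unfolding L[symmetric] by (auto simp: perp_def B_simps)
      then show False using splits_inter[OF assms(1) M'(1)] x by blast
    qed
    then show ?thesis using L by simp
  qed
  have finF: "finite ?F"
    by (rule finite_subset[of _ "Pow U"]) (use U in \<open>auto simp: splits_of_dim_def splits_def\<close>)
  have "U - singular U = (\<Union>M\<in>?F. M - {0})"
  proof
    show "(\<Union>M\<in>?F. M - {0}) \<subseteq> U - singular U"
      using F by (auto simp: singular_def) (auto simp: splits_of_dim_def splits_def)
    show "U - singular U \<subseteq> (\<Union>M\<in>?F. M - {0})"
    proof
      fix x assume "x \<in> U - singular U"
      then have x: "x \<in> U" "B x x \<noteq> 0" by (auto simp: singular_def)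
      then have "x \<noteq> 0" by auto
      then have "?L x \<in> ?F"
        using line_in_splits[OF U(1) x] card_line by (simp add: splits_of_dim_def)
      moreover have "x = 1 \<star> x" by simp
      then have "x \<in> ?L x" by (rule range_eqI)
      ultimately show "x \<in> (\<Union>M\<in>?F. M - {0})" using \<open>x \<noteq> 0\<close> by blast
    qed
  qed
  then have "card (U - singular U) = card (\<Union>M\<in>?F. M - {0})" by simp
  also have "\<dots> = (\<Sum>M\<in>?F. card (M - {0}))"
  proof (rule card_UN_disjoint[OF finF])
    show "\<forall>M\<in>?F. finite (M - {0})"
      using U(2) finite_subset by (auto simp: splits_of_dim_def splits_def)
    show "\<forall>M\<in>?F. \<forall>N\<in>?F. M \<noteq> N \<longrightarrow> (M - {0}) \<inter> (N - {0}) = {}"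
      using F by blast
  qed
  also have "\<dots> = (\<Sum>M\<in>?F. CARD('a) - 1)"
    by (rule sum.cong) (auto simp: splits_of_dim_def splits_def subspace_0 card_Diff_singleton)
  finally have "card ?F * (CARD('a) - 1) = card (U - singular U)" by simp
  also have "\<dots> = CARD('a) ^ (2 * n + 1) - CARD('a) ^ (2 * n)"
    using card_singular[OF assms] assms(2) U(2) by (subst card_Diff_subset) (auto simp: singular_def)
  also have "\<dots> = CARD('a) ^ (2 * n) * (CARD('a) - 1)"
    by (simp add: algebra_simps)
  finally show ?thesis using CARD_gt_1 by simp
qed

text \<open>In this form the quotient of two such counts contributes a single factor to each of two
  \<open>qpoch\<close> products.\<close>

lemma card_hyperbolic_pairs_real:
  assumes "nondeg U" "card U = CARD('a) ^ (2 * n + 1)"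
  defines "x \<equiv> 1 / (real CARD('a))\<^sup>2"
  shows "real (card (hyperbolic_pairs U)) = real CARD('a) ^ (4 * n) * (1 - x ^ n) / real CARD('a)"
proof -
  let ?Q = "real CARD('a)"
  have Q: "?Q > 0" using CARD_gt_1 by simp
  have "1 \<le> CARD('a) ^ (2 * n)" using CARD_gt_1 by simp
  then have "real (CARD('a) ^ (2 * n) - 1) = ?Q ^ (2 * n) - 1"
    by (simp add: of_nat_diff)
  then have "real (card (hyperbolic_pairs U)) * ?Q = (?Q ^ (2 * n) - 1) * ?Q ^ (2 * n)"
    using arg_cong[OF card_hyperbolic_pairs[OF assms(1,2)], of real] by simp
  also have "\<dots> = ?Q ^ (4 * n) * (1 - x ^ n)"
  proof -
    have "x ^ n = 1 / ?Q ^ (2 * n)" by (simp add: x_def power_divide power_mult)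
    moreover have "?Q ^ (4 * n) = ?Q ^ (2 * n) * ?Q ^ (2 * n)" by (simp flip: power_add)
    ultimately show ?thesis using Q by (simp add: field_simps)
  qed
  finally show ?thesis using Q by (simp add: field_simps)
qed

text \<open>Induction on \<open>n\<close> with \<open>m\<close> fixed. At \<open>n = m\<close> the
  complements are lines, already counted; each step solves the double count for the larger
  space.\<close>

lemma card_splits_of_dim:
  assumes "nondeg U" "card U = CARD('a) ^ (2 * n + 1)" "m \<le> n"
  defines "x \<equiv> 1 / (real CARD('a))\<^sup>2"
  shows "real (card (splits_of_dim U (2 * m))) =
    real CARD('a) ^ (2 * m * (2 * (n - m) + 1)) * (qpoch x n / (qpoch x m * qpoch x (n - m)))"
  using assms(3,1,2)
proof (induction n arbitrary: U rule: dec_induct)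
  case base
  have "0 < x" "x < 1" using CARD_gt_1 by (auto simp: x_def power2_eq_square less_1_mult)
  moreover have "card (splits_of_dim U (2 * m)) = card (splits_of_dim U 1)"
    using bij_betw_perp[OF base(1)] base(2) bij_betw_same_card by blast
  ultimately show ?case
    using card_splits_of_dim_1[OF base] qpoch_pos[of x m] by simp
next
  case (step n)
  let ?Q = "real CARD('a)"
  let ?R = "?Q ^ (2 * m * (2 * (n - m) + 1)) * (qpoch x n / (qpoch x m * qpoch x (n - m)))"
  have Q: "?Q > 0" using CARD_gt_1 by simp
  have x: "0 < x" "x < 1" using CARD_gt_1 by (auto simp: x_def power2_eq_square less_1_mult)
  define d where "d = n - m"
  have n: "n = m + d" using step(1) by (simp add: d_def)
  define g where "g = ?Q ^ (4 * Suc d) * (1 - x ^ Suc d) / ?Q"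
  have "real (card (splits_of_dim U (2 * m))) * g = real (card (hyperbolic_pairs U)) * ?R"
  proof (rule double_count_hyperbolic_pairs[OF step.prems(1)])
    fix W assume W: "nondeg W" "card W * CARD('a) ^ 2 = card U"
    then have "card W * CARD('a) ^ 2 = CARD('a) ^ (2 * n + 1) * CARD('a) ^ 2"
      using step.prems(2) by (simp add: eval_nat_numeral)
    then have "card W = CARD('a) ^ (2 * n + 1)" by simp
    then show "real (card (splits_of_dim W (2 * m))) = ?R" using step.IH W(1) by blast
  next
    fix M assume "M \<in> splits_of_dim U (2 * m)"
    then have M: "M \<in> splits U" "card M = CARD('a) ^ (2 * m)" by (auto simp: splits_of_dim_def)
    have e: "2 * Suc n + 1 = 2 * m + (2 * Suc d + 1)" by (simp add: n)
    have "CARD('a) ^ (2 * m) * card (perp U M) = CARD('a) ^ (2 * m) * CARD('a) ^ (2 * Suc d + 1)"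
      using card_splits[OF step.prems(1) M(1)] M(2) step.prems(2) unfolding e power_add by metis
    then have "card (perp U M) = CARD('a) ^ (2 * Suc d + 1)" by simp
    from card_hyperbolic_pairs_real[OF nondeg_perp[OF step.prems(1) M(1)] this]
    show "real (card (hyperbolic_pairs (perp U M))) = g" unfolding g_def x_def .
  qed
  also have "real (card (hyperbolic_pairs U)) = ?Q ^ (4 * Suc n) * (1 - x ^ Suc n) / ?Q"
    unfolding x_def by (rule card_hyperbolic_pairs_real[OF step.prems])
  finally have main: "real (card (splits_of_dim U (2 * m))) * g =
      ?Q ^ (4 * Suc n) * (1 - x ^ Suc n) / ?Q * ?R" .
  have nz: "1 - x ^ Suc d > 0" "qpoch x k > 0" for k
    using qpoch_factor_pos[OF x] qpoch_pos[OF x] by auto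
  then have g: "g \<noteq> 0" using Q unfolding g_def by simp
  \<comment> \<open>The pair counts of \<open>U\<close> and of the complement of \<open>M\<close>
    differ by q^(4m) in their powers of q, which is the growth of the claimed exponent when
    \<open>n\<close> rises by one.\<close>
  have ex: "?Q ^ (4 * Suc n) * ?Q ^ (2 * m * (2 * d + 1)) = ?Q ^ (4 * Suc d) * ?Q ^ (2 * m * (2 * Suc d + 1))"
    unfolding power_add[symmetric] by (rule arg_cong[of _ _ "power ?Q"]) (simp add: n algebra_simps)
  have "Suc n - m = Suc d" by (simp add: n)
  have "?Q ^ (4 * Suc n) * (1 - x ^ Suc n) / ?Q * ?R =
      (?Q ^ (4 * Suc n) * ?Q ^ (2 * m * (2 * d + 1))) * (1 - x ^ Suc n) / ?Q *
      (qpoch x n / (qpoch x m * qpoch x d))"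
    by (simp add: d_def)
  also have "\<dots> = (?Q ^ (2 * m * (2 * Suc d + 1)) * (qpoch x (Suc n) / (qpoch x m * qpoch x (Suc d)))) * g"
    unfolding ex g_def qpoch_Suc using nz(1) by (simp add: ac_simps)
  finally show ?case
    unfolding \<open>Suc n - m = Suc d\<close> using main mult_right_cancel[OF g] by metis
qed

text \<open>Complements carry dimension 2m+1 to 2(n-m), so the odd part of the sum is the even part
  read backwards.\<close>

lemma card_splits_eq_sum:
  assumes "nondeg U" "card U = CARD('a) ^ (2 * n + 1)"
  shows "card (splits U) = 2 * (\<Sum>m\<le>n. card (splits_of_dim U (2 * m)))"
proof -
  have U: "subspace U" "finite U" using assms nondegD by auto
  have fin: "finite (splits U)"
    by (rule finite_subset[of _ "Pow U"]) (use U in \<open>auto simp: splits_def\<close>)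
  then have finD: "finite (splits_of_dim U k)" for k
    by (rule finite_subset[rotated]) (auto simp: splits_of_dim_def)
  have disj: "splits_of_dim U i \<inter> splits_of_dim U j = {}" if "i \<noteq> j" for i j
    using that CARD_gt_1 by (auto simp: splits_of_dim_def power_inject_exp)
  have "splits U = (\<Union>k\<le>2 * n + 1. splits_of_dim U k)"
  proof
    show "splits U \<subseteq> (\<Union>k\<le>2 * n + 1. splits_of_dim U k)"
    proof
      fix M assume M: "M \<in> splits U"
      then have M': "subspace M" "finite M" "card M \<le> card U"
        using U finite_subset card_mono[OF U(2)] by (auto simp: splits_def)
      then obtain k where k: "card M = CARD('a) ^ k" using card_subspace by metis
      then have "k \<le> 2 * n + 1"
        using M'(3) assms(2) CARD_gt_1 by (metis power_le_imp_le_exp)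
      then show "M \<in> (\<Union>k\<le>2 * n + 1. splits_of_dim U k)"
        using M k by (auto simp: splits_of_dim_def)
    qed
  qed (auto simp: splits_of_dim_def)
  then have "card (splits U) = (\<Sum>k\<le>2 * n + 1. card (splits_of_dim U k))"
    using finD disj by (simp add: card_UN_disjoint)
  also have "\<dots> = (\<Sum>m\<le>n. card (splits_of_dim U (2 * m))) + (\<Sum>m\<le>n. card (splits_of_dim U (2 * m + 1)))"
    by (induction n) (simp_all add: algebra_simps)
  also have "(\<Sum>m\<le>n. card (splits_of_dim U (2 * m + 1))) = (\<Sum>m\<le>n. card (splits_of_dim U (2 * (n - m))))"
  proof (rule sum.cong)
    fix m assume "m \<in> {..n}"
    then have "2 * n + 1 = (2 * m + 1) + 2 * (n - m)" by simp
    then have "card U = CARD('a) ^ ((2 * m + 1) + 2 * (n - m))" using assms(2) by metis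
    then show "card (splits_of_dim U (2 * m + 1)) = card (splits_of_dim U (2 * (n - m)))"
      using bij_betw_perp[OF assms(1)] bij_betw_same_card by blast
  qed simp
  also have "\<dots> = (\<Sum>m\<le>n. card (splits_of_dim U (2 * m)))"
    by (rule sum.reindex_bij_witness[where i = "\<lambda>m. n - m" and j = "\<lambda>m. n - m"]) auto
  finally show ?thesis by simp
qed

text \<open>With j = n - 2m the exponent deficit n^2 + n - 2m(2(n-m)+1) is j(j+1), twice a
  triangular number; hence the base q^-2. For negative j the same product is formed from -1-j, which
  is the second branch of the conditional.\<close>

lemma card_splits_normalised:
  assumes "nondeg U" "card U = CARD('a) ^ (2 * n + 1)"
  defines "x \<equiv> 1 / (real CARD('a))\<^sup>2"
  shows "real (card (splits U)) / real CARD('a) ^ (n\<^sup>2 + n) =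
    2 * (\<Sum>m\<le>n. x ^ (triangle (if 2 * m \<le> n then n - 2 * m else 2 * m - n - 1)) *
      (qpoch x n / (qpoch x m * qpoch x (n - m))))"
proof -
  let ?Q = "real CARD('a)" and ?T = "\<lambda>m. triangle (if 2 * m \<le> n then n - 2 * m else 2 * m - n - 1)"
  have Q: "?Q > 0" using CARD_gt_1 by simp
  have summand: "real (card (splits_of_dim U (2 * m))) / ?Q ^ (n\<^sup>2 + n) =
      x ^ ?T m * (qpoch x n / (qpoch x m * qpoch x (n - m)))" if m: "m \<le> n" for m
  proof -
    have tri: "2 * triangle k = k * (k + 1)" for k by (induction k) auto
    have "2 * m * (2 * (n - m) + 1) + 2 * ?T m = n\<^sup>2 + n"
    proof (cases "2 * m \<le> n")
      case True
      then obtain d where d: "n = 2 * m + d" using le_Suc_ex by blast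
      then have "2 * ?T m = d * (d + 1)" using tri[of d] by simp
      moreover have "n - m = m + d" using d by simp
      ultimately show ?thesis by (simp add: d power2_eq_square algebra_simps)
    next
      case False
      define d where "d = 2 * m - n - 1"
      define e where "e = n - m"
      have d: "m = d + 1 + e" "n = d + 1 + 2 * e" using m False by (auto simp: d_def e_def)
      have "?T m = triangle d" using False by (simp add: d_def)
      then have "2 * ?T m = d * (d + 1)" using tri[of d] by simp
      then have "2 * m * (2 * (n - m) + 1) + 2 * ?T m = 2 * m * (2 * e + 1) + d * (d + 1)"
        by (simp only: e_def)
      also have "\<dots> = n\<^sup>2 + n"
        unfolding d by (simp add: power2_eq_square algebra_simps)
      finally show ?thesis .
    qed
    then have "?Q ^ (n\<^sup>2 + n) = ?Q ^ (2 * m * (2 * (n - m) + 1)) * ?Q ^ (2 * ?T m)"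
      by (metis power_add)
    moreover have "x ^ ?T m = 1 / ?Q ^ (2 * ?T m)"
      by (simp only: x_def power_divide power_mult power_one)
    moreover have "real (card (splits_of_dim U (2 * m))) =
        ?Q ^ (2 * m * (2 * (n - m) + 1)) * (qpoch x n / (qpoch x m * qpoch x (n - m)))"
      unfolding x_def by (rule card_splits_of_dim[OF assms(1,2) m])
    moreover have "?Q ^ (2 * m * (2 * (n - m) + 1)) \<noteq> 0" "?Q ^ (2 * ?T m) \<noteq> 0"
      using Q by simp_all
    moreover have "a * p / (a * b) = 1 / b * p" if "a \<noteq> 0" "b \<noteq> 0" for a b p :: real
      using that by simp
    ultimately show ?thesis by metis
  qed
  have "real (card (splits U)) / ?Q ^ (n\<^sup>2 + n) =
      2 * (\<Sum>m\<le>n. real (card (splits_of_dim U (2 * m))) / ?Q ^ (n\<^sup>2 + n))"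
    unfolding card_splits_eq_sum[OF assms(1,2)] by (simp flip: sum_divide_distrib)
  also have "(\<Sum>m\<le>n. real (card (splits_of_dim U (2 * m))) / ?Q ^ (n\<^sup>2 + n)) =
      (\<Sum>m\<le>n. x ^ ?T m * (qpoch x n / (qpoch x m * qpoch x (n - m))))"
    by (rule sum.cong) (auto simp only: summand atMost_iff)
  finally show ?thesis .
qed

section \<open>Involutions and splittings\<close>

text \<open>Isometry is stated through \<open>B x x\<close>, in accordance with a group that
  preserves the quadratic form; preservation of \<open>B\<close> follows by polarisation. All
  conditions are relative to \<open>U\<close>, as values elsewhere carry no information.\<close>

definition isometric_involution :: "'v set \<Rightarrow> ('v \<Rightarrow> 'v) \<Rightarrow> bool" where
  "isometric_involution U \<sigma> \<longleftrightarrow>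
     (\<forall>x\<in>U. \<sigma> x \<in> U \<and> \<sigma> (\<sigma> x) = x \<and> B (\<sigma> x) (\<sigma> x) = B x x) \<and>
     (\<forall>x\<in>U. \<forall>y\<in>U. \<sigma> (x + y) = \<sigma> x + \<sigma> y) \<and>
     (\<forall>c. \<forall>x\<in>U. \<sigma> (c \<star> x) = c \<star> \<sigma> x)"

lemma isometric_involution_B:
  assumes U: "subspace U" and \<sigma>: "isometric_involution U \<sigma>" and x: "x \<in> U" and y: "y \<in> U"
  shows "B (\<sigma> x) (\<sigma> y) = B x y"
proof -
  have "B (\<sigma> (x + y)) (\<sigma> (x + y)) = B (x + y) (x + y)" "\<sigma> (x + y) = \<sigma> x + \<sigma> y"
    "B (\<sigma> x) (\<sigma> x) = B x x" "B (\<sigma> y) (\<sigma> y) = B y y"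
    using \<sigma> x y subspace_add[OF U x y] by (auto simp: isometric_involution_def)
  then have "2 * B (\<sigma> x) (\<sigma> y) = 2 * B x y"
    using sym[of y x] sym[of "\<sigma> y" "\<sigma> x"] by (simp add: B_simps)
  then show ?thesis using two_neq_0 by simp
qed

text \<open>The decomposition is into (x - \<open>\<sigma> x\<close>)/2 and (x +
  \<open>\<sigma> x\<close>)/2. A fixed \<open>x\<close> and a negated \<open>y\<close> satisfy
  \<open>B x y = - B x y\<close>, so they are orthogonal.\<close>

lemma negated_space:
  assumes U: "nondeg U" and \<sigma>: "isometric_involution U \<sigma>"
  shows "{x \<in> U. \<sigma> x = - x} \<in> splits U" (is "?M \<in> _")
    and "perp U {x \<in> U. \<sigma> x = - x} = {x \<in> U. \<sigma> x = x}"
proof -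
  have sU: "subspace U" using U nondegD by blast
  have add: "\<sigma> (x + y) = \<sigma> x + \<sigma> y" and scl: "\<sigma> (c \<star> x) = c \<star> \<sigma> x"
    and inU: "\<sigma> x \<in> U" and inv: "\<sigma> (\<sigma> x) = x" if "x \<in> U" "y \<in> U" for x y c
    using \<sigma> that by (auto simp: isometric_involution_def)
  have fix_perp: "x \<in> perp U ?M" if "x \<in> U" "\<sigma> x = x" for x
  proof -
    have "B x y = 0" if y: "y \<in> ?M" for y
    proof -
      have "B (\<sigma> x) (\<sigma> y) = B x y"
        using isometric_involution_B[OF sU \<sigma>] \<open>x \<in> U\<close> y by blast
      moreover have "\<sigma> y = (- 1) \<star> y" using y by simp
      ultimately have "- B x y = B x y" using \<open>\<sigma> x = x\<close> by (simp only: scale_right) simp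
      then have "2 * B x y = 0" by (metis add.right_inverse mult_2)
      then show ?thesis using two_neq_0 by simp
    qed
    then show ?thesis using that by (simp add: perp_def)
  qed
  have dec: "\<exists>a\<in>?M. x - a \<in> U \<and> \<sigma> (x - a) = x - a" if x: "x \<in> U" for x
  proof -
    \<comment> \<open>The difference is written as a sum with
      \<open>(- 1) \<star> \<sigma> x\<close>, so that additivity and homogeneity of
      \<open>\<sigma>\<close> apply directly.\<close>
    let ?a = "inverse 2 \<star> (x + (- 1) \<star> \<sigma> x)" and ?b = "inverse 2 \<star> (x + \<sigma> x)"
    have "?a + ?b = inverse 2 \<star> (x + x)"
      unfolding scale_right_distrib[symmetric] by (simp add: algebra_simps)
    also have "\<dots> = (inverse 2 + inverse 2) \<star> x"
      by (simp only: scale_right_distrib scale_left_distrib)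
    also have "inverse 2 + inverse 2 = (1 :: 'a)"
      using two_neq_0 by (metis mult_2 right_inverse)
    finally have "x = ?a + ?b" by simp
    then have ab: "x - ?a = ?b" by (metis add_diff_cancel_left')
    have mem: "x + \<sigma> x \<in> U" "(- 1) \<star> \<sigma> x \<in> U" "x + (- 1) \<star> \<sigma> x \<in> U" "\<sigma> x \<in> U"
      using inU[OF x x] x subspace_add[OF sU] subspace_scale[OF sU] by blast+
    have "\<sigma> ?a = - ?a"
      using mem x by (simp only: add scl inv) (simp add: algebra_simps)
    moreover have "\<sigma> ?b = ?b"
      using mem x by (simp only: add scl inv) (simp add: algebra_simps)
    moreover have "?a \<in> U" "?b \<in> U" using mem subspace_scale[OF sU] by blast+
    ultimately show ?thesis using ab by (intro bexI[of _ ?a]) auto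
  qed
  have "subspace ?M"
  proof (rule subspaceI)
    show "0 \<in> ?M" using subspace_0[OF sU] scl[of 0 0 0] by auto
  qed (auto simp: add scl subspace_add[OF sU] subspace_scale[OF sU])
  then show M: "?M \<in> splits U"
    using dec fix_perp by (fastforce simp: splits_def)
  show "perp U ?M = {x \<in> U. \<sigma> x = x}"
  proof
    show "{x \<in> U. \<sigma> x = x} \<subseteq> perp U ?M" using fix_perp by blast
    show "perp U ?M \<subseteq> {x \<in> U. \<sigma> x = x}"
    proof
      fix x assume x: "x \<in> perp U ?M"
      then have xU: "x \<in> U" by (simp add: perp_def)
      then obtain a where a: "a \<in> ?M" "x - a \<in> U" "\<sigma> (x - a) = x - a" using dec by blast
      then have "x - (x - a) \<in> perp U ?M"
        using x fix_perp subspace_diff subspace_perp[OF sU] by blast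
      then have "a = 0" using splits_inter[OF U M a(1)] by simp
      then show "x \<in> {x \<in> U. \<sigma> x = x}" using a xU by simp
    qed
  qed
qed

lemma isometric_involution_unique:
  assumes U: "nondeg U" and \<sigma>: "isometric_involution U \<sigma>" and \<tau>: "isometric_involution U \<tau>"
    and eq: "{x \<in> U. \<sigma> x = - x} = {x \<in> U. \<tau> x = - x}" and x: "x \<in> U"
  shows "\<sigma> x = \<tau> x"
proof -
  obtain a b where ab: "a \<in> {x \<in> U. \<sigma> x = - x}" "b \<in> perp U {x \<in> U. \<sigma> x = - x}" "x = a + b"
    using splitsE[OF negated_space(1)[OF U \<sigma>] x] .
  then have "b \<in> {x \<in> U. \<sigma> x = x}" "b \<in> {x \<in> U. \<tau> x = x}" "a \<in> {x \<in> U. \<tau> x = - x}"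
    using eq negated_space(2)[OF U \<sigma>] negated_space(2)[OF U \<tau>] by auto
  then show ?thesis using ab \<sigma> \<tau> by (auto simp: isometric_involution_def)
qed

text \<open>The involution is 1 - 2p, where p is the projection onto \<open>M\<close> along its
  complement. Projections are chosen pointwise, and their linearity comes from uniqueness of the
  decomposition.\<close>

lemma isometric_involution_exists:
  assumes U: "nondeg U" and M: "M \<in> splits U"
  obtains \<sigma> where "isometric_involution U \<sigma>" "{x \<in> U. \<sigma> x = - x} = M"
proof -
  have sU: "subspace U" using U nondegD by blast
  have sM: "subspace M" "M \<subseteq> U" using M by (auto simp: splits_def)
  have sP: "subspace (perp U M)" using subspace_perp[OF sU] .
  define p where "p x = (SOME a. a \<in> M \<and> x - a \<in> perp U M)" for x
  have p: "p x \<in> M" "x - p x \<in> perp U M" if "x \<in> U" for x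
    using someI_ex[of "\<lambda>a. a \<in> M \<and> x - a \<in> perp U M"] M that by (auto simp: p_def splits_def)
  have p_unique: "p x = a" if "x \<in> U" "a \<in> M" "x - a \<in> perp U M" for x a
  proof -
    have "(x - a) - (x - p x) \<in> perp U M" "p x - a \<in> M"
      using p that sP sM subspace_diff by blast+
    then have "p x - a = 0" using splits_inter[OF U M, of "p x - a"] by simp
    then show ?thesis by simp
  qed
  define \<sigma> where "\<sigma> x = x - (p x + p x)" for x
  have p_add: "p (x + y) = p x + p y" if "x \<in> U" "y \<in> U" for x y
  proof (rule p_unique)
    show "x + y - (p x + p y) \<in> perp U M"
      using subspace_add[OF sP p(2)[OF that(1)] p(2)[OF that(2)]] by (simp add: algebra_simps)
  qed (use that p sU sM subspace_add in blast)+
  have p_scale: "p (c \<star> x) = c \<star> p x" if "x \<in> U" for x c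
  proof (rule p_unique)
    show "c \<star> x - c \<star> p x \<in> perp U M"
      using subspace_scale[OF sP p(2)[OF that], of c] by (simp add: algebra_simps)
  qed (use that p sU sM subspace_scale in blast)+
  have p_M: "p x = x" if "x \<in> M" for x
    by (rule p_unique) (use that sM subspace_0[OF sP] in auto)
  \<comment> \<open>This yields \<open>\<sigma> (\<sigma> x) = x\<close>: the second application
    adds back what the first one subtracted.\<close>
  have p_sigma: "p (\<sigma> x) = - p x" if "x \<in> U" for x
  proof (rule p_unique)
    show "\<sigma> x \<in> U"
      unfolding \<sigma>_def using that p(1)[OF that] sM(2) subspace_diff[OF sU] subspace_add[OF sU] by blast
    show "- p x \<in> M" using p(1)[OF that] subspace_neg[OF sM(1)] by blast
    show "\<sigma> x - - p x \<in> perp U M" using p(2)[OF that] by (simp add: \<sigma>_def)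
  qed
  have "isometric_involution U \<sigma>"
    unfolding isometric_involution_def
  proof (intro conjI ballI allI)
    fix x assume x: "x \<in> U"
    show "\<sigma> x \<in> U"
      unfolding \<sigma>_def using x p(1)[OF x] sM(2) subspace_diff[OF sU] subspace_add[OF sU] by blast
    show "\<sigma> (\<sigma> x) = x" using p_sigma[OF x] by (simp add: \<sigma>_def)
    have o: "B (x - p x) (p x) = 0" using p[OF x] by (auto simp: perp_def)
    then have "B x (p x) = B (p x) (p x)" "B (p x) x = B (p x) (p x)"
      using sym[of "p x" x] by (simp_all add: B_simps)
    then show "B (\<sigma> x) (\<sigma> x) = B x x" by (simp add: \<sigma>_def B_simps)
  qed (simp_all add: \<sigma>_def p_add p_scale algebra_simps)
  moreover have "{x \<in> U. \<sigma> x = - x} = M"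
  proof
    show "M \<subseteq> {x \<in> U. \<sigma> x = - x}" using sM(2) p_M by (auto simp: \<sigma>_def)
    show "{x \<in> U. \<sigma> x = - x} \<subseteq> M"
    proof clarify
      fix x assume x: "x \<in> U" "\<sigma> x = - x"
      then have "x + x = p x + p x" by (simp add: \<sigma>_def algebra_simps)
      then have "2 \<star> (x - p x) = 0"
        by (simp add: scale_left_distrib[of 1 1, simplified] algebra_simps)
      then have "x = p x" using two_neq_0 by simp
      then show "x \<in> M" using p(1)[OF x(1)] by metis
    qed
  qed
  ultimately show thesis using that by blast
qed

end

section \<open>Transfer to vectors and matrices\<close>

text \<open>Vectors of all dimensions share one type, on which addition is not a group operation.
  Coordinate functions on the naturals do form a group, and the space of dimension \<open>m\<close>
  sits in it as the functions vanishing from \<open>m\<close> on.\<close>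

definition fun_scale :: "'a::field \<Rightarrow> (nat \<Rightarrow> 'a) \<Rightarrow> nat \<Rightarrow> 'a" where
  "fun_scale c f = (\<lambda>i. c * f i)"

definition vec_fun :: "'a::field vec \<Rightarrow> nat \<Rightarrow> 'a" where
  "vec_fun w = (\<lambda>i. if i < dim_vec w then w $ i else 0)"

definition fun_space :: "nat \<Rightarrow> (nat \<Rightarrow> 'a::field) set" where
  "fun_space m = {f. \<forall>i\<ge>m. f i = 0}"

lemma vec_vec_fun: "w \<in> carrier_vec m \<Longrightarrow> vec m (vec_fun w) = w"
  by (auto simp: vec_fun_def)

lemma vec_fun_vec: "f \<in> fun_space m \<Longrightarrow> vec_fun (vec m f) = f"
  by (auto simp: vec_fun_def fun_space_def)

lemma vec_fun_mem: "w \<in> carrier_vec m \<Longrightarrow> vec_fun w \<in> fun_space m"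
  by (auto simp: vec_fun_def fun_space_def)

lemma vec_plus: "vec m (f + g) = vec m f + vec m g"
  by auto

lemma vec_fun_scale: "vec m (fun_scale c f) = c \<cdot>\<^sub>v vec m f"
  by (auto simp: fun_scale_def)

lemma card_fun_space:
  "finite (fun_space m :: (nat \<Rightarrow> 'a::{field, finite}) set)"
  "card (fun_space m :: (nat \<Rightarrow> 'a) set) = CARD('a) ^ m"
proof -
  have b: "bij_betw (\<lambda>f. restrict f {..<m}) (fun_space m :: (nat \<Rightarrow> 'a) set) ({..<m} \<rightarrow>\<^sub>E UNIV)"
    by (rule bij_betw_byWitness[where f' = "\<lambda>f i. if i < m then f i else 0"])
       (auto simp: fun_space_def fun_eq_iff PiE_def extensional_def)
  show "finite (fun_space m :: (nat \<Rightarrow> 'a) set)"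
    using bij_betw_finite[OF b] by (simp add: finite_PiE)
  show "card (fun_space m :: (nat \<Rightarrow> 'a) set) = CARD('a) ^ m"
    using bij_betw_same_card[OF b] by (simp add: card_PiE)
qed

lemma mat_eq_by_mult_vec:
  fixes A C :: "'a::field mat"
  assumes "A \<in> carrier_mat m m" "C \<in> carrier_mat m m"
    and eq: "\<And>v. v \<in> carrier_vec m \<Longrightarrow> A *\<^sub>v v = C *\<^sub>v v"
  shows "A = C"
proof (rule eq_matI)
  fix i j assume ij: "i < dim_row C" "j < dim_col C"
  then have "(A *\<^sub>v unit_vec m j) $ i = (C *\<^sub>v unit_vec m j) $ i"
    using eq[of "unit_vec m j"] by simp
  then show "A $$ (i, j) = C $$ (i, j)" using ij assms(1,2) by simp
qed (use assms in auto)

locale quadratic_space =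
  fixes m :: nat and Q :: "'a::{field, finite} vec \<Rightarrow> 'a"
  assumes odd: "odd CARD('a)" and quad: "quadratic_form m Q" and nondeg_form: "nondegenerate m Q"
begin

lemma polar_sym:
  assumes "u \<in> carrier_vec m" "v \<in> carrier_vec m"
  shows "polar_form Q u v = polar_form Q v u"
  using assms by (simp add: polar_form_def comm_add_vec[of u m v] algebra_simps)

text \<open>The form is pulled back along \<open>vec m\<close>. It is degenerate on the ambient
  space, as coordinates from \<open>m\<close> on are ignored, but not on
  \<open>fun_space m\<close>.\<close>

sublocale symmetric_form fun_scale "\<lambda>f g. polar_form Q (vec m f) (vec m g)"
proof
  fix f g h :: "nat \<Rightarrow> 'a" and c
  show "polar_form Q (vec m (f + g)) (vec m h) =
      polar_form Q (vec m f) (vec m h) + polar_form Q (vec m g) (vec m h)"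
    using quad unfolding vec_plus quadratic_form_def by simp
  show "polar_form Q (vec m (fun_scale c f)) (vec m h) = c * polar_form Q (vec m f) (vec m h)"
    using quad unfolding vec_fun_scale quadratic_form_def by simp
  show "polar_form Q (vec m f) (vec m g) = polar_form Q (vec m g) (vec m f)"
    by (rule polar_sym) auto
qed (auto simp: fun_scale_def fun_eq_iff algebra_simps odd)

lemma polar_self: "v \<in> carrier_vec m \<Longrightarrow> polar_form Q v v = 2 * Q v"
proof -
  assume v: "v \<in> carrier_vec m"
  have "v + v = 2 \<cdot>\<^sub>v v" by (rule eq_vecI) auto
  then have "Q (v + v) = 2\<^sup>2 * Q v" using quad v by (simp add: quadratic_form_def)
  then show ?thesis by (simp add: polar_form_def)
qed

lemma nondeg_fun_space: "nondeg (fun_space m)"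
  unfolding nondeg_def
proof (intro conjI ballI impI)
  show "subspace (fun_space m)" by (rule subspaceI) (auto simp: fun_space_def fun_scale_def)
  show "finite (fun_space m :: (nat \<Rightarrow> 'a) set)" by (rule card_fun_space)
next
  fix f :: "nat \<Rightarrow> 'a"
  assume f: "f \<in> fun_space m" "\<forall>g\<in>fun_space m. polar_form Q (vec m f) (vec m g) = 0"
  have "polar_form Q (vec m f) w = 0" if "w \<in> carrier_vec m" for w
    using f(2) vec_fun_mem[OF that] vec_vec_fun[OF that] by metis
  then have "vec m f = 0\<^sub>v m" using nondeg_form by (simp add: nondegenerate_def)
  then have "f = vec_fun (0\<^sub>v m)" using vec_fun_vec[OF f(1)] by simp
  also have "\<dots> = 0" by (auto simp: vec_fun_def fun_eq_iff)
  finally show "f = 0" .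
qed

definition matrix_action :: "'a mat \<Rightarrow> (nat \<Rightarrow> 'a) \<Rightarrow> nat \<Rightarrow> 'a" where
  "matrix_action g f = vec_fun (g *\<^sub>v vec m f)"

lemma vec_matrix_action:
  "g \<in> carrier_mat m m \<Longrightarrow> vec m (matrix_action g f) = g *\<^sub>v vec m f"
  by (simp add: matrix_action_def vec_vec_fun)

lemma matrix_action_involution:
  assumes g: "g \<in> involutions m Q"
  shows "isometric_involution (fun_space m) (matrix_action g)"
proof -
  have g: "g \<in> carrier_mat m m" "g * g = 1\<^sub>m m" "\<And>v. v \<in> carrier_vec m \<Longrightarrow> Q (g *\<^sub>v v) = Q v"
    using g by (auto simp: involutions_def orthogonal_group_def)
  have c: "g *\<^sub>v vec m f \<in> carrier_vec m" for f using g(1) by simp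
  show ?thesis
    unfolding isometric_involution_def
  proof (intro conjI ballI allI)
    fix f :: "nat \<Rightarrow> 'a" assume f: "f \<in> fun_space m"
    show "matrix_action g f \<in> fun_space m"
      unfolding matrix_action_def by (rule vec_fun_mem[OF c])
    have "g *\<^sub>v (g *\<^sub>v vec m f) = vec m f"
      using g by (metis assoc_mult_mat_vec one_mult_mat_vec vec_carrier)
    then show "matrix_action g (matrix_action g f) = f"
      using vec_matrix_action[OF g(1)] vec_fun_vec[OF f] by (simp add: matrix_action_def)
    show "polar_form Q (vec m (matrix_action g f)) (vec m (matrix_action g f)) =
        polar_form Q (vec m f) (vec m f)"
      using g(3)[of "vec m f"] c by (simp add: vec_matrix_action[OF g(1)] polar_self)
    fix h :: "nat \<Rightarrow> 'a" assume h: "h \<in> fun_space m"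
    show "matrix_action g (f + h) = matrix_action g f + matrix_action g h"
      using g(1) unfolding matrix_action_def vec_plus
      by (subst mult_add_distrib_mat_vec[OF g(1)]) (auto simp: vec_fun_def fun_eq_iff)
  next
    fix c and f :: "nat \<Rightarrow> 'a"
    show "matrix_action g (fun_scale c f) = fun_scale c (matrix_action g f)"
      using g(1) unfolding matrix_action_def vec_fun_scale
      by (subst mult_mat_vec[OF g(1)]) (auto simp: vec_fun_def fun_eq_iff fun_scale_def)
  qed
qed

text \<open>The columns are the images of the unit functions; involutivity makes the matrix its own
  inverse.\<close>

lemma matrix_of_involution:
  assumes \<sigma>: "isometric_involution (fun_space m) \<sigma>"
  obtains g where "g \<in> involutions m Q" "\<And>f. f \<in> fun_space m \<Longrightarrow> matrix_action g f = \<sigma> f"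
proof -
  define e :: "nat \<Rightarrow> nat \<Rightarrow> 'a" where "e j = (\<lambda>i. if i = j then 1 else 0)" for j
  define g where "g = mat m m (\<lambda>(i, j). \<sigma> (e j) i)"
  have g: "g \<in> carrier_mat m m" by (simp add: g_def)
  have e: "e j \<in> fun_space m" if "j < m" for j using that by (auto simp: e_def fun_space_def)
  have sV: "subspace (fun_space m)" using nondeg_fun_space nondegD by blast
  have \<sigma>_mem: "\<sigma> f \<in> fun_space m" if "f \<in> fun_space m" for f
    using \<sigma> that by (auto simp: isometric_involution_def)
  \<comment> \<open>Additivity is available for two summands at a time, so \<open>f\<close> is built
    up one coordinate after another; the empty truncation uses homogeneity with scalar 0.\<close>
  have trunc: "\<sigma> (\<lambda>i. if i < k then f i else 0) i = (\<Sum>j<k. \<sigma> (e j) i * f j)" if "k \<le> m" for k f i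
    using that
  proof (induction k)
    case 0
    have z: "fun_scale 0 h = 0" for h :: "nat \<Rightarrow> 'a" by (simp add: fun_scale_def fun_eq_iff)
    have "\<sigma> (fun_scale 0 0) = fun_scale 0 (\<sigma> 0)"
      using \<sigma> subspace_0[OF sV] unfolding isometric_involution_def by blast
    then have "\<sigma> 0 = 0" by (simp only: z)
    from fun_cong[OF this, of i] show ?case by (simp add: zero_fun_def)
  next
    case (Suc k)
    have split: "(\<lambda>i. if i < Suc k then f i else 0) = (\<lambda>i. if i < k then f i else 0) + fun_scale (f k) (e k)"
      by (auto simp: fun_eq_iff e_def fun_scale_def less_Suc_eq)
    have mem: "(\<lambda>i. if i < k then f i else 0) \<in> fun_space m" "e k \<in> fun_space m"
      using Suc.prems e by (auto simp: fun_space_def)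
    then have "fun_scale (f k) (e k) \<in> fun_space m" using subspace_scale[OF sV] by blast
    then have "\<sigma> (\<lambda>i. if i < Suc k then f i else 0) =
        \<sigma> (\<lambda>i. if i < k then f i else 0) + fun_scale (f k) (\<sigma> (e k))"
      using \<sigma> mem unfolding split isometric_involution_def by metis
    then show ?case using Suc by (simp add: fun_scale_def)
  qed
  have act: "matrix_action g f = \<sigma> f" if f: "f \<in> fun_space m" for f
  proof
    fix i
    have "(\<lambda>i. if i < m then f i else 0) = f" using f by (auto simp: fun_space_def)
    then have "\<sigma> f i = (\<Sum>j<m. \<sigma> (e j) i * f j)" using trunc[of m f i] by simp
    moreover have "\<sigma> f i = 0" if "\<not> i < m" using \<sigma>_mem[OF f] that by (simp add: fun_space_def)
    ultimately show "matrix_action g f i = \<sigma> f i"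
      by (auto simp: matrix_action_def vec_fun_def g_def scalar_prod_def atLeast0LessThan)
  qed
  have gv: "g *\<^sub>v v = vec m (\<sigma> (vec_fun v))" if "v \<in> carrier_vec m" for v
    using act[OF vec_fun_mem[OF that]] vec_matrix_action[OF g] vec_vec_fun[OF that] by metis
  have sq: "g * g = 1\<^sub>m m"
  proof (rule mat_eq_by_mult_vec)
    fix v :: "'a vec" assume v: "v \<in> carrier_vec m"
    have "(g * g) *\<^sub>v v = g *\<^sub>v (g *\<^sub>v v)" using g v by simp
    also have "\<dots> = vec m (\<sigma> (\<sigma> (vec_fun v)))"
      using gv v \<sigma>_mem[OF vec_fun_mem[OF v]] by (simp add: vec_fun_vec)
    also have "\<dots> = v"
      using \<sigma> vec_fun_mem[OF v] vec_vec_fun[OF v] by (simp add: isometric_involution_def)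
    finally show "(g * g) *\<^sub>v v = 1\<^sub>m m *\<^sub>v v" using v by simp
  qed (use g in auto)
  have "Q (g *\<^sub>v v) = Q v" if v: "v \<in> carrier_vec m" for v
  proof -
    have "polar_form Q (g *\<^sub>v v) (g *\<^sub>v v) = polar_form Q v v"
      using \<sigma> vec_fun_mem[OF v] vec_vec_fun[OF v] unfolding gv[OF v] isometric_involution_def by metis
    then have "2 * Q (g *\<^sub>v v) = 2 * Q v"
      using polar_self v g by (metis mult_mat_vec_carrier)
    then show ?thesis using two_neq_0 by simp
  qed
  moreover have "invertible_mat g"
    using g sq unfolding invertible_mat_def inverts_mat_def by auto
  ultimately have "g \<in> involutions m Q"
    using g sq by (simp add: involutions_def orthogonal_group_def)
  then show thesis using that act by blast
qed

text \<open>A matrix corresponds to its (-1)-eigenspace: injectivity holds since the action on that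
  space and its complement is prescribed, surjectivity by realising the reflection 1 - 2p as a
  matrix.\<close>

lemma num_involutions_eq_card_splits: "num_involutions m Q = card (splits (fun_space m))"
proof -
  let ?V = "fun_space m :: (nat \<Rightarrow> 'a) set"
  have "bij_betw (\<lambda>g. {f \<in> ?V. matrix_action g f = - f}) (involutions m Q) (splits ?V)"
  proof (rule bij_betw_imageI)
    show "inj_on (\<lambda>g. {f \<in> ?V. matrix_action g f = - f}) (involutions m Q)"
    proof (rule inj_onI)
      fix g h assume gh: "g \<in> involutions m Q" "h \<in> involutions m Q"
        "{f \<in> ?V. matrix_action g f = - f} = {f \<in> ?V. matrix_action h f = - f}"
      have c: "g \<in> carrier_mat m m" "h \<in> carrier_mat m m"
        using gh by (auto simp: involutions_def orthogonal_group_def)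
      show "g = h"
      proof (rule mat_eq_by_mult_vec[OF c])
        fix v :: "'a vec" assume v: "v \<in> carrier_vec m"
        have "matrix_action g (vec_fun v) = matrix_action h (vec_fun v)"
          using isometric_involution_unique[OF nondeg_fun_space matrix_action_involution[OF gh(1)]
              matrix_action_involution[OF gh(2)] gh(3) vec_fun_mem[OF v]] .
        then show "g *\<^sub>v v = h *\<^sub>v v"
          using vec_matrix_action c vec_vec_fun[OF v] by metis
      qed
    qed
    show "(\<lambda>g. {f \<in> ?V. matrix_action g f = - f}) ` involutions m Q = splits ?V"
    proof
      show "(\<lambda>g. {f \<in> ?V. matrix_action g f = - f}) ` involutions m Q \<subseteq> splits ?V"
        by (rule image_subsetI) (rule negated_space(1)[OF nondeg_fun_space matrix_action_involution])
      show "splits ?V \<subseteq> (\<lambda>g. {f \<in> ?V. matrix_action g f = - f}) ` involutions m Q"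
      proof
        fix M assume "M \<in> splits ?V"
        then obtain \<sigma> where \<sigma>: "isometric_involution ?V \<sigma>" "{f \<in> ?V. \<sigma> f = - f} = M"
          by (rule isometric_involution_exists[OF nondeg_fun_space])
        obtain g where g: "g \<in> involutions m Q" "\<And>f. f \<in> ?V \<Longrightarrow> matrix_action g f = \<sigma> f"
          by (rule matrix_of_involution[OF \<sigma>(1)]) (rule that, blast+)
        then have "M = {f \<in> ?V. matrix_action g f = - f}" using \<sigma>(2) by auto
        then show "M \<in> (\<lambda>g. {f \<in> ?V. matrix_action g f = - f}) ` involutions m Q" using g(1) by blast
      qed
    qed
  qed
  then show ?thesis unfolding num_involutions_def by (rule bij_betw_same_card)
qed

end

theorem theorem5p3:
  fixes q :: nat
    and Q :: "nat \<Rightarrow> 'a::{field, finite} vec \<Rightarrow> 'a"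
  assumes "primepow q" and "odd q"
    and "CARD('a) = q"
    and "\<And>n. quadratic_form (2 * n + 1) (Q n)"
    and "\<And>n. nondegenerate (2 * n + 1) (Q n)"
  shows "(\<lambda>n. real (num_involutions (2 * n + 1) (Q n)) / real q ^ (n\<^sup>2 + n))
           \<longlonglongrightarrow> 2 * (\<Prod>i. (1 + 1 / real q ^ (2 * (i + 1)))\<^sup>2)"
proof -
  define x where "x = 1 / (real q)\<^sup>2"
  have eq: "real (num_involutions (2 * n + 1) (Q n)) / real q ^ (n\<^sup>2 + n) =
      2 * (\<Sum>m\<le>n. x ^ (triangle (if 2 * m \<le> n then n - 2 * m else 2 * m - n - 1)) *
        (qpoch x n / (qpoch x m * qpoch x (n - m))))" for n
  proof -
    \<comment> \<open>The interpretation is made for each \<open>n\<close> separately, since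
      dimension and form vary with it; the resulting count no longer mentions the form.\<close>
    interpret quadratic_space "2 * n + 1" "Q n"
      by unfold_locales (use assms in auto)
    show ?thesis
      unfolding num_involutions_eq_card_splits x_def assms(3)[symmetric]
      by (rule card_splits_normalised[OF nondeg_fun_space card_fun_space(2)])
  qed
  have "q \<noteq> 1" "q > 0"
    using assms(1,2) by (auto simp: odd_pos)
  then have "1 < q" by simp
  then have "0 < x" "x < 1" by (simp_all add: x_def)
  then have "(\<lambda>n. real (num_involutions (2 * n + 1) (Q n)) / real q ^ (n\<^sup>2 + n))
      \<longlonglongrightarrow> 2 * (\<Prod>i. (1 + x ^ Suc i)\<^sup>2)"
    unfolding eq by (intro tendsto_mult_left sum_exponents_tendsto)
  moreover have "x ^ Suc i = 1 / real q ^ (2 * (i + 1))" for i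
    by (simp only: x_def power_divide power_one power_mult Suc_eq_plus1)
  ultimately show ?thesis by (simp only:)
qed

end
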